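(* Let $p\in(0,1)$ be fixed (independent of $n$). For almost all graphs $G$ in the Erdős–Rényi model $G_{n,p}$, the energy of the Randić matrix $R(G)$ satisfies $$\mathscr{E}(R(G))=(1+o(1))\cdot\frac{8}{3\pi}\sqrt{\frac{1-p}{p}}\cdot n^{1/2}.$$
   Context: $G_{n,p}$ is the model of random simple graphs on vertex set $\{1,\dots,n\}$ in which each edge is present independently with probability $p$; $d_i$ is the degree of vertex $i$ in $G=(V,E)$. $R(G)$ is the $n\times n$ matrix with $(i,j)$-entry $\frac{1}{\sqrt{d_id_j}}$ if $ij\in E$ and $0$ otherwise. The energy of a real symmetric matrix $A$ with eigenvalues $\lambda_1,\dots,\lambda_n$ is $\mathscr{E}(A)=\sum_{i=1}^n|\lambda_i|$. "Almost all" means with probability tending to $1$ as $n\to\infty$; thus "for almost all graphs, $\mathscr{E}=(1+o(1))g(n)$" means that for every $\varepsilon>0$, $\Pr(|\mathscr{E}/g(n)-1|>\varepsilon)\to0$ as $n\to\infty$. *)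

theory Defs
  imports
    "HOL-Probability.Probability"
    "Jordan_Normal_Form.Char_Poly"
begin

text \<open>A simple graph on the vertex set \<open>{1..n}\<close> is represented by its set of edges, an edge
  being a two-element subset of \<open>{1..n}\<close>.\<close>

definition all_edges :: "nat \<Rightarrow> nat set set" where
  "all_edges n = {e. e \<subseteq> {1..n} \<and> card e = 2}"

definition degree_of :: "nat set set \<Rightarrow> nat \<Rightarrow> nat" where
  "degree_of E v = card {e \<in> E. v \<in> e}"

definition erdos_renyi :: "nat \<Rightarrow> real \<Rightarrow> nat set set pmf" where
  "erdos_renyi n p =
     map_pmf (\<lambda>f. {e \<in> all_edges n. f e})
       (Pi_pmf (all_edges n) False (\<lambda>_. bernoulli_pmf p))"

text \<open>Matrix indices start at 0, so row \<open>i\<close> belongs to the vertex \<open>Suc i\<close>. On the diagonal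
  \<open>{Suc i, Suc j}\<close> is a singleton and hence never an edge.\<close>

definition randic_matrix :: "nat \<Rightarrow> nat set set \<Rightarrow> real mat" where
  "randic_matrix n E = mat n n (\<lambda>(i, j).
     if {Suc i, Suc j} \<in> E
     then 1 / sqrt (real (degree_of E (Suc i)) * real (degree_of E (Suc j)))
     else 0)"

text \<open>The multiset of real roots of the characteristic polynomial is the full spectrum with
  multiplicities only if all eigenvalues are real; the notion is meant for symmetric matrices.\<close>

definition energy :: "real mat \<Rightarrow> real" where
  "energy A = (\<Sum>x\<in>#proots (char_poly A). \<bar>x\<bar>)"

end

theory Submission
  imports Defs "HOL-Real_Asymp.Real_Asymp"
begin

text \<open>The energy of a symmetric matrix is its trace norm, hence stable under perturbations. When all
degrees are close to \<open>p n\<close>, the Randic matrix is close in Frobenius norm to the adjacency matrix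
divided by \<open>p n\<close>, and removing the mean \<open>p\<close> from the off-diagonal entries changes the energy of
that matrix by at most 2. Hence \<open>\<E>(R(G))\<close> is, up to \<open>o(\<surd>n)\<close>, equal to
\<open>\<surd>((1-p)/p) / \<surd>n\<close> times the energy of the matrix \<open>W\<close> whose off-diagonal entries are centred
Bernoulli variables of variance \<open>1/n\<close> (\<open>randic_energy_close\<close>; the degrees are controlled by
Hoeffding's inequality and a union bound). It remains to prove the semicircle law in the form
\<open>\<E>(W)/n \<rightarrow> 8/(3\<pi>)\<close>, the mean of \<open>\<bar>x\<bar>\<close> under the semicircle distribution.

The absolute value is recovered from resolvents by \<open>\<bar>x\<bar> = (2/\<pi>) \<integral> x\<^sup>2/(x\<^sup>2+t\<^sup>2) dt\<close> over
\<open>t > 0\<close>. If \<open>G = (W - it)\<inverse>\<close> and \<open>m = tr G / n\<close>, then \<open>(1/n) \<Sum> \<lambda>\<^sup>2/(\<lambda>\<^sup>2+t\<^sup>2) = 1 - t Im m\<close>,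
so only the normalized trace on the imaginary axis matters, where every entry of \<open>G\<close> has the
deterministic bound \<open>1/t\<close>.

The quantity \<open>Y = 1 + i t m + m\<^sup>2\<close> vanishes in the limit. Indeed \<open>1 + i t m = (1/n) \<Sum> W\<^sub>i\<^sub>j G\<^sub>j\<^sub>i\<close>, and for
a Bernoulli variable \<open>\<xi>\<close> one has the exact identity \<open>E (\<xi>-p) F(\<xi>) = p(1-p) (F(1) - F(0))\<close>, a discrete
integration by parts. Applied to \<open>F = G\<^sub>j\<^sub>i cnj(Y)\<close>, with the resolvent identity for the
difference (\<open>entry_flip\<close>), it shows that \<open>E (1 + i t m) cnj(Y)\<close> equals \<open>-E m\<^sup>2 cnj(Y)\<close> up to
\<open>O(1/\<surd>n)\<close>, that is, \<open>E \<bar>Y\<bar>\<^sup>2 = O(1/\<surd>n)\<close> (\<open>semicircle_defect_second_moment\<close>). Taking \<open>cnj(Y)\<close> itself as the test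
function gives the equation and its concentration at once. The equation is stable
(\<open>semicircle_fixed_point_stable\<close>): its root with positive imaginary part is \<open>i s(t)\<close> with
\<open>s(t) = (\<surd>(t\<^sup>2+4) - t)/2\<close>, and \<open>\<bar>m - i s\<bar> \<le> \<bar>Y\<bar>\<close>. Dominated convergence in \<open>t\<close> then yields
\<open>\<E>(W)/n \<rightarrow> (2/\<pi>) \<integral> (1 - t s(t)) dt = (2/\<pi>) \<integral> s(t)\<^sup>2 dt = (2/\<pi>) (4/3)\<close>.\<close>

unbundle no vec_syntax and no inner_syntax

section \<open>The spectral theorem for real symmetric matrices\<close>

text \<open>The complexification has an eigenvalue \<open>z\<close>; comparing \<open>v\<^sup>* A v = z \<parallel>v\<parallel>\<^sup>2\<close> with its conjugate shows
that \<open>z\<close> is real, so \<open>z\<close> is already a root of the real characteristic polynomial.\<close>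

lemma symmetric_eigenvector:
  fixes A :: "real mat"
  assumes A: "A \<in> carrier_mat n n" and sym: "A\<^sup>T = A" and n: "0 < n"
  obtains l v where "v \<in> carrier_vec n" "v \<noteq> 0\<^sub>v n" "A *\<^sub>v v = l \<cdot>\<^sub>v v"
proof -
  let ?C = "map_mat complex_of_real A"
  have C: "?C \<in> carrier_mat n n" using A by simp
  have "degree (char_poly ?C) = n" using degree_monic_char_poly[OF C] by simp
  then have "\<not> constant (poly (char_poly ?C))" using n by (simp add: constant_degree)
  then obtain z where z: "poly (char_poly ?C) z = 0"
    using fundamental_theorem_of_algebra by blast
  then have "eigenvalue ?C z" using eigenvalue_root_char_poly[OF C] by simp
  then obtain v where v: "v \<in> carrier_vec n" "v \<noteq> 0\<^sub>v n" "?C *\<^sub>v v = z \<cdot>\<^sub>v v"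
    using C unfolding eigenvalue_def eigenvector_def by auto
  have Asym: "A $$ (i,j) = A $$ (j,i)" if "i < n" "j < n" for i j
    using arg_cong[OF sym, of "\<lambda>M. M $$ (i,j)"] that A by simp
  have ev: "(\<Sum>j<n. complex_of_real (A $$ (i,j)) * v $ j) = z * v $ i" if "i < n" for i
    using arg_cong[OF v(3), of "\<lambda>w. w $ i"] that v(1) A
    by (simp add: scalar_prod_def atLeast0LessThan)
  (* the quadratic form v* A v *)
  define S where "S = (\<Sum>i<n. \<Sum>j<n. cnj (v $ i) * complex_of_real (A $$ (i,j)) * v $ j)"
  define N where "N = (\<Sum>i<n. (cmod (v $ i))\<^sup>2)"
  have "S = (\<Sum>i<n. cnj (v $ i) * (z * v $ i))"
    unfolding S_def by (intro sum.cong refl) (simp add: ev[symmetric] sum_distrib_left mult.assoc)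
  also have "\<dots> = z * complex_of_real N"
    unfolding N_def of_real_sum sum_distrib_left
    by (intro sum.cong refl) (simp add: complex_norm_square del: of_real_power)
  finally have S: "S = z * complex_of_real N" .
  have "cnj S = (\<Sum>i<n. \<Sum>j<n. v $ i * complex_of_real (A $$ (i,j)) * cnj (v $ j))"
    unfolding S_def by simp
  also have "\<dots> = (\<Sum>j<n. \<Sum>i<n. v $ i * complex_of_real (A $$ (i,j)) * cnj (v $ j))"
    by (rule sum.swap)
  also have "\<dots> = S" unfolding S_def
    by (intro sum.cong refl) (simp add: Asym mult_ac)
  finally have "cnj z * complex_of_real N = z * complex_of_real N" unfolding S by simp
  moreover have "N > 0"
  proof -
    obtain i where i: "i < n" "v $ i \<noteq> 0" using v(1,2) by (metis carrier_vecD eq_vecI index_zero_vec)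
    then have "0 < (cmod (v $ i))\<^sup>2" by simp
    also have "\<dots> \<le> N" unfolding N_def using i by (intro member_le_sum) auto
    finally show ?thesis .
  qed
  ultimately have "z = complex_of_real (Re z)" by (auto simp: complex_eq_iff)
  then have "poly (char_poly ?C) (complex_of_real (Re z)) = 0" using z by simp
  then have "poly (char_poly A) (Re z) = 0"
    unfolding of_real_hom.char_poly_hom[OF A] by simp
  then have "eigenvalue A (Re z)" using eigenvalue_root_char_poly[OF A] by simp
  then show ?thesis using that A unfolding eigenvalue_def eigenvector_def by auto
qed

text \<open>\<open>H\<close> is the reflection that exchanges \<open>u\<close> and the first unit vector, \<open>1 - 2 w w\<^sup>T / \<parallel>w\<parallel>\<^sup>2\<close> with
\<open>w = u - e\<^sub>0\<close>. Since \<open>\<parallel>w\<parallel>\<^sup>2 = 2 (1 - u\<^sub>0)\<close>, the factor becomes \<open>1 / (1 - u\<^sub>0)\<close>; when \<open>u = e\<^sub>0\<close> this is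
\<open>1/0 = 0\<close> and the formula gives the identity, as it should.\<close>

lemma householder:
  fixes u :: "real vec"
  assumes u: "u \<in> carrier_vec n" and norm: "u \<bullet> u = 1" and n: "0 < n"
  obtains H where "H \<in> carrier_mat n n" "H\<^sup>T = H" "H * H = 1\<^sub>m n" "col H 0 = u"
proof
  define w where "w i = u $ i - (if i = 0 then 1 else 0)" for i
  define H where "H = mat n n (\<lambda>(i,j). (if i = j then 1 else 0) - w i * w j / (1 - u $ 0))"
  have uu: "(\<Sum>i<n. (u $ i)\<^sup>2) = 1"
    using norm u by (simp add: scalar_prod_def atLeast0LessThan power2_eq_square)
  have "(\<Sum>i<n. (w i)\<^sup>2) = (\<Sum>i<n. (u $ i)\<^sup>2 + (if i = 0 then 1 - 2 * u $ 0 else 0))"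
    by (intro sum.cong refl) (auto simp: w_def power2_eq_square algebra_simps)
  also have "\<dots> = 2 * (1 - u $ 0)" using n by (simp add: sum.distrib uu)
  finally have ww: "(\<Sum>i<n. (w i)\<^sup>2) = 2 * (1 - u $ 0)" .
  show "H \<in> carrier_mat n n" by (simp add: H_def)
  show "H\<^sup>T = H" by (rule eq_matI) (auto simp: H_def)
  show "H * H = 1\<^sub>m n"
  proof (rule eq_matI)
    fix i k assume ik: "i < dim_row (1\<^sub>m n)" "k < dim_col (1\<^sub>m n :: real mat)"
    let ?c = "1 - u $ 0"
    have cancel: "x / c\<^sup>2 * (2 * c) = 2 * (x / c)" for x c :: real
      by (cases "c = 0") (simp_all add: power2_eq_square)
    have "(H * H) $$ (i,k) = (\<Sum>j<n. ((if i = j then 1 else 0) - w i * w j / ?c) *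
        ((if j = k then 1 else 0) - w j * w k / ?c))"
      using ik by (simp add: H_def scalar_prod_def atLeast0LessThan)
    also have "\<dots> = (\<Sum>j<n. (if i = j then (if j = k then 1 else 0) - w j * w k / ?c else 0)
         - (if j = k then w i * w j / ?c else 0) + w i * w k / ?c\<^sup>2 * (w j)\<^sup>2)"
      by (intro sum.cong refl) (auto simp: power2_eq_square algebra_simps)
    also have "\<dots> = (if i = k then 1 else 0) - 2 * (w i * w k / ?c) + w i * w k / ?c\<^sup>2 * (2 * ?c)"
      unfolding sum.distrib sum_subtractf sum_distrib_left[symmetric] ww using ik by simp
    also have "\<dots> = 1\<^sub>m n $$ (i,k)"
      unfolding cancel using ik by simp
    finally show "(H * H) $$ (i,k) = 1\<^sub>m n $$ (i,k)" .
  qed (auto simp: H_def)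
  show "col H 0 = u"
  proof (rule eq_vecI)
    fix i assume i: "i < dim_vec u"
    show "col H 0 $ i = u $ i"
    proof (cases "u $ 0 = 1")
      case True
      then have "(\<Sum>i<n. (w i)\<^sup>2) = 0" using ww by simp
      then have "w i = 0" using i u by (auto simp: sum_nonneg_eq_0_iff)
      then show ?thesis using i u n True by (auto simp: H_def w_def)
    next
      case False
      then show ?thesis using i u n by (auto simp: H_def w_def field_simps)
    qed
  qed (use u n in \<open>auto simp: H_def\<close>)
qed

text \<open>Induction by deflation: reflecting a unit eigenvector into the first coordinate makes the first
column, hence by symmetry also the first row, of \<open>H A H\<close> vanish off the diagonal.\<close>

theorem real_spectral_theorem:
  fixes A :: "real mat"
  assumes "A \<in> carrier_mat n n" and "A\<^sup>T = A"
  shows "\<exists>P l. P \<in> carrier_mat n n \<and> P\<^sup>T * P = 1\<^sub>m n \<and>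
    A = P * mat n n (\<lambda>(i,j). if i = j then l i else 0) * P\<^sup>T"
  using assms
proof (induction n arbitrary: A)
  case 0
  then show ?case by (intro exI[of _ "1\<^sub>m 0"] exI[of _ "\<lambda>_. 0"]) (auto intro!: eq_matI)
next
  case (Suc m)
  let ?n = "Suc m"
  note A = Suc.prems(1)
  obtain e v where v: "v \<in> carrier_vec ?n" "v \<noteq> 0\<^sub>v ?n" "A *\<^sub>v v = e \<cdot>\<^sub>v v"
    using symmetric_eigenvector[OF Suc.prems] by blast
  define u where "u = (1 / sqrt (v \<bullet> v)) \<cdot>\<^sub>v v"
  have u: "u \<in> carrier_vec ?n" using v by (simp add: u_def)
  have Au: "A *\<^sub>v u = e \<cdot>\<^sub>v u"
    using A v by (simp add: u_def mult_mat_vec smult_smult_assoc mult.commute)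
  have vv: "v \<bullet> v > 0"
    using conjugate_square_greater_0_vec[OF v(1)] v by simp
  have uu: "u \<bullet> u = 1" using v vv by (simp add: u_def)
  obtain H where H: "H \<in> carrier_mat ?n ?n" "H\<^sup>T = H" "H * H = 1\<^sub>m ?n" "col H 0 = u"
    using householder[OF u uu] by blast
  (* H exchanges u and the first unit vector, so the latter is an eigenvector of B *)
  define B where "B = H * A * H"
  have B: "B \<in> carrier_mat ?n ?n" using H A by (simp add: B_def)
  have Bsym: "B\<^sup>T = B"
    using H A Suc.prems(2) 
    by (simp add: B_def transpose_mult[of _ ?n ?n _ ?n] assoc_mult_mat[of _ ?n ?n _ ?n _ ?n])
  have Hu: "H *\<^sub>v u = unit_vec ?n 0"
  proof -
    have "H *\<^sub>v u = H *\<^sub>v col H 0" using H by simp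
    also have "\<dots> = col (H * H) 0" using col_mult2[OF H(1) H(1), of 0] by simp
    finally show ?thesis using H(3) by simp
  qed
  have "col B 0 = (H * A) *\<^sub>v u"
    unfolding B_def H(4)[symmetric] using H A by (intro col_mult2[of _ ?n ?n _ ?n]) auto
  also have "\<dots> = H *\<^sub>v (A *\<^sub>v u)" by (rule assoc_mult_mat_vec[OF H(1) A u])
  also have "\<dots> = e \<cdot>\<^sub>v unit_vec ?n 0" using H u by (simp add: Au mult_mat_vec Hu)
  finally have colB: "col B 0 = e \<cdot>\<^sub>v unit_vec ?n 0" .
  have B0: "B $$ (i,0) = (if i = 0 then e else 0)" if "i < ?n" for i
    using arg_cong[OF colB, of "\<lambda>v. v $ i"] that B by auto
  have B0': "B $$ (0,i) = (if i = 0 then e else 0)" if "i < ?n" for i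
    using arg_cong[OF Bsym, of "\<lambda>M. M $$ (i,0)"] that B B0[OF that] by auto
  define A' where "A' = mat m m (\<lambda>(i,j). B $$ (Suc i, Suc j))"
  have A': "A' \<in> carrier_mat m m" by (simp add: A'_def)
  have A'sym: "A'\<^sup>T = A'"
  proof (rule eq_matI)
    fix i j assume "i < dim_row A'" "j < dim_col A'"
    then show "A'\<^sup>T $$ (i,j) = A' $$ (i,j)" using A' B
        arg_cong[OF Bsym, of "\<lambda>M. M $$ (Suc i, Suc j)"] by (auto simp: A'_def)
  qed (use A' in auto)
  obtain P' l' where P': "P' \<in> carrier_mat m m" "P'\<^sup>T * P' = 1\<^sub>m m"
    and A'eq: "A' = P' * mat m m (\<lambda>(i,j). if i = j then l' i else 0) * P'\<^sup>T"
    using Suc.IH[OF A' A'sym] by blast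
  define D' where "D' = mat m m (\<lambda>(i,j). if i = j then l' i else 0 :: real)"
  have D': "D' \<in> carrier_mat m m" by (simp add: D'_def)
  define l where "l i = (case i of 0 \<Rightarrow> e | Suc j \<Rightarrow> l' j)" for i
  define D where "D = mat ?n ?n (\<lambda>(i,j). if i = j then l i else 0)"
  let ?z1 = "0\<^sub>m 1 m :: real mat" and ?z2 = "0\<^sub>m m 1 :: real mat"
  define Q where "Q = four_block_mat (1\<^sub>m 1) ?z1 ?z2 P'"
  define E where "E = mat 1 1 (\<lambda>_. e)"
  have E: "E \<in> carrier_mat 1 1" by (simp add: E_def)
  have Q: "Q \<in> carrier_mat ?n ?n" using four_block_carrier_mat[of "1\<^sub>m 1" 1 1 P' m m] P' by (simp add: Q_def)
  have QT: "Q\<^sup>T = four_block_mat (1\<^sub>m 1) ?z1 ?z2 (P'\<^sup>T)"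
    unfolding Q_def using P' by (subst transpose_four_block_mat[of _ 1 1 _ m _ m]) auto
  have Deq: "D = four_block_mat E ?z1 ?z2 D'"
    by (rule eq_matI) (auto simp: D_def D'_def E_def l_def split: nat.splits)
  have Beq: "B = four_block_mat E ?z1 ?z2 A'"
  proof (rule eq_matI)
    fix i j assume ij: "i < dim_row (four_block_mat E ?z1 ?z2 A')" "j < dim_col (four_block_mat E ?z1 ?z2 A')"
    then show "B $$ (i,j) = four_block_mat E ?z1 ?z2 A' $$ (i,j)"
      using B0[of i] B0'[of j] A' by (cases i; cases j) (auto simp: E_def A'_def)
  qed (use A' B in \<open>auto simp: E_def\<close>)
  have PT: "P'\<^sup>T \<in> carrier_mat m m" using P' by simp
  have QQ: "Q\<^sup>T * Q = 1\<^sub>m ?n"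
    unfolding QT unfolding Q_def using P'
    by (subst mult_four_block_mat[of _ 1 1 _ m _ m _ _ 1 _ m]) auto
  have QDQ: "Q * D * Q\<^sup>T = B"
  proof -
    have "Q * D = four_block_mat E ?z1 ?z2 (P' * D')"
      unfolding Q_def Deq using P' E D'
      by (subst mult_four_block_mat[of _ 1 1 _ m _ m _ _ 1 _ m]) auto
    also have "\<dots> * Q\<^sup>T = four_block_mat E ?z1 ?z2 (P' * D' * P'\<^sup>T)"
      unfolding QT using P' E D'
      by (subst mult_four_block_mat[of _ 1 1 _ m _ m _ _ 1 _ m]) auto
    finally show ?thesis unfolding Beq A'eq D'_def .
  qed
  define P where "P = H * Q"
  have D: "D \<in> carrier_mat ?n ?n" by (simp add: D_def)
  have PTeq: "P\<^sup>T = Q\<^sup>T * H" unfolding P_def using H Q by (simp add: transpose_mult[of _ ?n ?n _ ?n])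
  have QTc: "Q\<^sup>T \<in> carrier_mat ?n ?n" using Q by simp
  note assoc = assoc_mult_mat[of _ ?n ?n _ ?n _ ?n]
  have "P\<^sup>T * P = Q\<^sup>T * (H * H) * Q"
    unfolding PTeq unfolding P_def using H(1) Q QTc by (simp add: assoc)
  also have "\<dots> = 1\<^sub>m ?n" using H(3) Q QTc QQ by simp
  finally have PP: "P\<^sup>T * P = 1\<^sub>m ?n" .
  have "P * D * P\<^sup>T = H * (Q * D * Q\<^sup>T) * H"
    unfolding PTeq unfolding P_def using H(1) Q QTc D by (simp add: assoc)
  also have "\<dots> = (H * H) * A * (H * H)"
    unfolding QDQ unfolding B_def using H(1) A by (simp add: assoc)
  also have "\<dots> = A" using H(3) A by simp
  finally have "A = P * D * P\<^sup>T" by simp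
  then show ?case using PP H(1) Q unfolding D_def by (intro exI[of _ P] exI[of _ l]) (auto simp: P_def)
qed

text \<open>From here on matrices are functions on index pairs and matrix products are explicit finite sums:
\<open>P\<close> is orthogonal and \<open>X = P diag(l) P\<^sup>T\<close>.\<close>

definition spectral_decomposition ::
    "nat \<Rightarrow> (nat \<Rightarrow> nat \<Rightarrow> real) \<Rightarrow> (nat \<Rightarrow> nat \<Rightarrow> real) \<Rightarrow> (nat \<Rightarrow> real) \<Rightarrow> bool" where
  "spectral_decomposition n X P l \<longleftrightarrow>
     (\<forall>k<n. \<forall>h<n. (\<Sum>i<n. P i k * P i h) = (if k = h then 1 else 0)) \<and>
     (\<forall>i<n. \<forall>j<n. (\<Sum>k<n. P i k * P j k) = (if i = j then 1 else 0)) \<and>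
     (\<forall>i<n. \<forall>j<n. X i j = (\<Sum>k<n. P i k * l k * P j k))"

lemma spectral_decomposition_exists:
  assumes "\<And>i j. i < n \<Longrightarrow> j < n \<Longrightarrow> X i j = X j i"
  shows "\<exists>P l. spectral_decomposition n X P l \<and>
           energy (mat n n (\<lambda>(i,j). X i j)) = (\<Sum>k<n. \<bar>l k\<bar>)"
proof -
  let ?A = "mat n n (\<lambda>(i,j). X i j)"
  have "?A\<^sup>T = ?A" by (rule eq_matI) (auto simp: assms)
  then obtain P l where P: "P \<in> carrier_mat n n" "P\<^sup>T * P = 1\<^sub>m n"
    and A: "?A = P * mat n n (\<lambda>(i,j). if i = j then l i else 0) * P\<^sup>T"
    using real_spectral_theorem[of ?A n] by auto
  define D where "D = mat n n (\<lambda>(i,j). if i = j then l i else 0 :: real)"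
  have D: "D \<in> carrier_mat n n" by (simp add: D_def)
  have PT: "P\<^sup>T \<in> carrier_mat n n" using P by simp
  have PP: "P * P\<^sup>T = 1\<^sub>m n" using mat_mult_left_right_inverse[OF PT P(1) P(2)] .
  have 1: "(\<Sum>i<n. P $$ (i,k) * P $$ (i,h)) = (if k = h then 1 else 0)" if "k < n" "h < n" for k h
    using arg_cong[OF P(2), of "\<lambda>M. M $$ (k,h)"] that P(1)
    by (simp add: scalar_prod_def atLeast0LessThan)
  have 2: "(\<Sum>k<n. P $$ (i,k) * P $$ (j,k)) = (if i = j then 1 else 0)" if "i < n" "j < n" for i j
    using arg_cong[OF PP, of "\<lambda>M. M $$ (i,j)"] that P(1)
    by (simp add: scalar_prod_def atLeast0LessThan)
  have PD: "(P * D) $$ (i,k) = P $$ (i,k) * l k" if "i < n" "k < n" for i k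
  proof -
    have "(P * D) $$ (i,k) = (\<Sum>j<n. P $$ (i,j) * (if j = k then l j else 0))"
      using that P(1) by (simp add: scalar_prod_def atLeast0LessThan D_def)
    also have "\<dots> = (\<Sum>j<n. if j = k then P $$ (i,j) * l j else 0)"
      by (intro sum.cong refl) auto
    finally show ?thesis using that by simp
  qed
  have 3: "X i j = (\<Sum>k<n. P $$ (i,k) * l k * P $$ (j,k))" if "i < n" "j < n" for i j
  proof -
    have "X i j = (P * D * P\<^sup>T) $$ (i,j)"
      using arg_cong[OF A, of "\<lambda>M. M $$ (i,j)"] that by (simp add: D_def)
    also have "\<dots> = (\<Sum>k<n. (P * D) $$ (i,k) * P $$ (j,k))"
      using that P(1) D by (subst index_mult_mat(1)) (auto simp: scalar_prod_def atLeast0LessThan)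
    also have "\<dots> = (\<Sum>k<n. P $$ (i,k) * l k * P $$ (j,k))"
      using that by (intro sum.cong refl) (simp add: PD)
    finally show ?thesis .
  qed
  have "similar_mat ?A D"
    unfolding similar_mat_def using A PP P PT D
    by (intro exI[of _ P] exI[of _ "P\<^sup>T"]) (auto simp: similar_mat_wit_def Let_def D_def)
  then have "char_poly ?A = char_poly D" by (rule char_poly_similar)
  also have "\<dots> = (\<Prod>a\<leftarrow>diag_mat D. [:- a, 1:])"
    by (rule char_poly_upper_triangular[OF D]) (auto simp: D_def upper_triangular_def)
  also have "diag_mat D = map l [0..<n]" by (auto simp: diag_mat_def D_def)
  finally have cp: "char_poly ?A = (\<Prod>a\<leftarrow>map l [0..<n]. [:- a, 1:])" .
  have "proots (\<Prod>a\<leftarrow>xs. [:- a, 1:]) = mset xs" for xs :: "real list"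
  proof (induction xs)
    case (Cons a xs)
    have "(\<Prod>a\<leftarrow>xs. [:- a, 1:]) \<noteq> 0" by (auto simp: prod_list_zero_iff)
    then have "proots ([:- a, 1:] * (\<Prod>a\<leftarrow>xs. [:- a, 1:])) = proots [:- a, 1:] + proots (\<Prod>a\<leftarrow>xs. [:- a, 1:])"
      by (intro proots_mult) auto
    then show ?case using Cons by (simp del: mult_pCons_left)
  qed simp
  from this[of "map l [0..<n]"] have "energy ?A = (\<Sum>k<n. \<bar>l k\<bar>)"
    unfolding energy_def cp
    by (simp add: sum_unfold_sum_mset atLeast0LessThan[symmetric] image_mset.compositionality o_def)
  then show ?thesis using 1 2 3 unfolding spectral_decomposition_def
    by (intro exI[of _ "\<lambda>i j. P $$ (i,j)"] exI[of _ l]) auto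
qed

section \<open>Energy as a maximum over orthogonal matrices\<close>

text \<open>For square matrices this is orthogonality.\<close>

definition orthonormal_columns :: "nat \<Rightarrow> (nat \<Rightarrow> nat \<Rightarrow> real) \<Rightarrow> bool" where
  "orthonormal_columns n U \<longleftrightarrow> (\<forall>k<n. \<forall>h<n. (\<Sum>i<n. U i k * U i h) = (if k = h then 1 else 0))"

lemma orthonormal_columns_isometry:
  assumes "orthonormal_columns n U"
  shows "(\<Sum>i<n. (\<Sum>j<n. U i j * x j)\<^sup>2) = (\<Sum>j<n. (x j)\<^sup>2)"
proof -
  have "(\<Sum>i<n. (\<Sum>j<n. U i j * x j)\<^sup>2) = (\<Sum>i<n. \<Sum>j<n. \<Sum>k<n. x j * x k * (U i j * U i k))"
    by (simp add: power2_eq_square sum_product mult_ac)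
  also have "\<dots> = (\<Sum>j<n. \<Sum>i<n. \<Sum>k<n. x j * x k * (U i j * U i k))"
    by (rule sum.swap)
  also have "\<dots> = (\<Sum>j<n. \<Sum>k<n. \<Sum>i<n. x j * x k * (U i j * U i k))"
    by (intro sum.cong refl sum.swap)
  also have "\<dots> = (\<Sum>j<n. \<Sum>k<n. if j = k then x j * x k else 0)"
    using assms by (intro sum.cong refl)
      (auto simp: orthonormal_columns_def sum_distrib_left[symmetric])
  finally show ?thesis by (simp add: power2_eq_square)
qed

lemma orthonormal_columns_bilinear:
  assumes "orthonormal_columns n U"
  shows "\<bar>\<Sum>i<n. \<Sum>j<n. y i * U i j * x j\<bar> \<le> sqrt (\<Sum>i<n. (y i)\<^sup>2) * sqrt (\<Sum>j<n. (x j)\<^sup>2)"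
proof -
  have "(\<Sum>i<n. \<Sum>j<n. y i * U i j * x j) = (\<Sum>i<n. y i * (\<Sum>j<n. U i j * x j))"
    by (simp add: sum_distrib_left mult.assoc)
  then have "(\<Sum>i<n. \<Sum>j<n. y i * U i j * x j)\<^sup>2 \<le> (\<Sum>i<n. (y i)\<^sup>2) * (\<Sum>j<n. (x j)\<^sup>2)"
    using Cauchy_Schwarz_ineq_sum[of y "\<lambda>i. \<Sum>j<n. U i j * x j" "{..<n}"]
    by (simp add: orthonormal_columns_isometry[OF assms])
  from real_sqrt_le_mono[OF this] show ?thesis by (simp add: real_sqrt_mult)
qed

lemma orthonormal_columns_frobenius:
  assumes "orthonormal_columns n U"
  shows "\<bar>\<Sum>i<n. \<Sum>j<n. F i j * U i j\<bar> \<le> sqrt (\<Sum>i<n. \<Sum>j<n. (F i j)\<^sup>2) * sqrt n"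
proof -
  have U: "(\<Sum>i<n. \<Sum>j<n. (U i j)\<^sup>2) = n"
    using assms by (subst sum.swap) (simp add: orthonormal_columns_def power2_eq_square)
  have "(\<Sum>i<n. \<Sum>j<n. F i j * U i j)\<^sup>2 \<le> (\<Sum>i<n. \<Sum>j<n. (F i j)\<^sup>2) * (\<Sum>i<n. \<Sum>j<n. (U i j)\<^sup>2)"
    using Cauchy_Schwarz_ineq_sum[of "\<lambda>(i,j). F i j" "\<lambda>(i,j). U i j" "{..<n} \<times> {..<n}"]
    by (simp add: sum.cartesian_product case_prod_unfold)
  from real_sqrt_le_mono[OF this] show ?thesis unfolding U by (simp add: real_sqrt_mult)
qed

lemma spectral_sum_expand:
  fixes l :: "nat \<Rightarrow> real"
  shows "(\<Sum>i<n. \<Sum>j<n. (\<Sum>k<n. P i k * l k * P j k) * U i j) =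
    (\<Sum>k<n. l k * (\<Sum>i<n. \<Sum>j<n. P i k * U i j * P j k))"
proof -
  have "(\<Sum>i<n. \<Sum>j<n. (\<Sum>k<n. P i k * l k * P j k) * U i j) =
      (\<Sum>i<n. \<Sum>j<n. \<Sum>k<n. l k * (P i k * U i j * P j k))"
    by (simp add: sum_distrib_left sum_distrib_right mult_ac)
  also have "\<dots> = (\<Sum>i<n. \<Sum>k<n. \<Sum>j<n. l k * (P i k * U i j * P j k))"
    by (intro sum.cong refl sum.swap)
  also have "\<dots> = (\<Sum>k<n. \<Sum>i<n. \<Sum>j<n. l k * (P i k * U i j * P j k))"
    by (rule sum.swap)
  finally show ?thesis by (simp add: sum_distrib_left)
qed

text \<open>In an eigenbasis of \<open>X\<close>, \<open>tr (X U\<^sup>T) = \<Sum> \<lambda>\<^sub>k \<langle>P\<^sub>k, U P\<^sub>k\<rangle>\<close>, and an isometry \<open>U\<close> has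
\<open>\<bar>\<langle>P\<^sub>k, U P\<^sub>k\<rangle>\<bar> \<le> 1\<close>.\<close>

lemma energy_ge_orthonormal:
  assumes sym: "\<And>i j. i < n \<Longrightarrow> j < n \<Longrightarrow> X i j = X j i" and U: "orthonormal_columns n U"
  shows "(\<Sum>i<n. \<Sum>j<n. X i j * U i j) \<le> energy (mat n n (\<lambda>(i,j). X i j))"
proof -
  obtain P l where sd: "spectral_decomposition n X P l"
    and en: "energy (mat n n (\<lambda>(i,j). X i j)) = (\<Sum>k<n. \<bar>l k\<bar>)"
    using spectral_decomposition_exists[of n X] sym by blast
  have "(\<Sum>i<n. \<Sum>j<n. X i j * U i j) = (\<Sum>i<n. \<Sum>j<n. (\<Sum>k<n. P i k * l k * P j k) * U i j)"
    using sd by (intro sum.cong refl) (auto simp: spectral_decomposition_def)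
  also have "\<dots> = (\<Sum>k<n. l k * (\<Sum>i<n. \<Sum>j<n. P i k * U i j * P j k))"
    by (rule spectral_sum_expand)
  also have "\<dots> \<le> (\<Sum>k<n. \<bar>l k\<bar>)"
  proof (rule sum_mono)
    fix k assume "k \<in> {..<n}"
    then have "\<bar>\<Sum>i<n. \<Sum>j<n. P i k * U i j * P j k\<bar> \<le> 1"
      using orthonormal_columns_bilinear[OF U, of "\<lambda>i. P i k" "\<lambda>j. P j k"] sd
      by (simp add: spectral_decomposition_def power2_eq_square)
    then have "\<bar>l k\<bar> * \<bar>\<Sum>i<n. \<Sum>j<n. P i k * U i j * P j k\<bar> \<le> \<bar>l k\<bar> * 1"
      by (intro mult_left_mono) auto
    then show "l k * (\<Sum>i<n. \<Sum>j<n. P i k * U i j * P j k) \<le> \<bar>l k\<bar>"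
      unfolding abs_mult[symmetric] by linarith
  qed
  finally show ?thesis using en by simp
qed

text \<open>The maximizer is the matrix sign of \<open>X\<close>, with the sign of \<open>0\<close> taken to be \<open>1\<close> so that it is
orthogonal.\<close>

lemma energy_attained:
  assumes sym: "\<And>i j. i < n \<Longrightarrow> j < n \<Longrightarrow> X i j = X j i"
  obtains U where "orthonormal_columns n U"
    "energy (mat n n (\<lambda>(i,j). X i j)) = (\<Sum>i<n. \<Sum>j<n. X i j * U i j)"
proof -
  obtain P l where sd: "spectral_decomposition n X P l"
    and en: "energy (mat n n (\<lambda>(i,j). X i j)) = (\<Sum>k<n. \<bar>l k\<bar>)"
    using spectral_decomposition_exists[of n X] sym by blast
  define s where "s k = (if l k \<ge> 0 then 1 else - 1 :: real)" for k
  define U where "U i j = (\<Sum>h<n. P i h * s h * P j h)" for i j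
  have P: "orthonormal_columns n P"
    using sd by (simp add: orthonormal_columns_def spectral_decomposition_def)
  have diag: "(\<Sum>i<n. \<Sum>j<n. P i k * U i j * P j k) = s k" if k: "k < n" for k
  proof -
    have "(\<Sum>i<n. \<Sum>j<n. P i k * U i j * P j k) =
        (\<Sum>i<n. \<Sum>j<n. (\<Sum>h<n. P i h * s h * P j h) * (P i k * P j k))"
      by (simp add: U_def mult_ac)
    also have "\<dots> = (\<Sum>h<n. s h * (\<Sum>i<n. \<Sum>j<n. P i h * (P i k * P j k) * P j h))"
      by (rule spectral_sum_expand)
    also have "\<dots> = (\<Sum>h<n. s h * ((\<Sum>i<n. P i h * P i k) * (\<Sum>j<n. P j k * P j h)))"
      by (simp add: sum_product mult_ac)
    also have "\<dots> = (\<Sum>h<n. if h = k then s h else 0)"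
      using P k by (intro sum.cong refl) (auto simp: orthonormal_columns_def)
    finally show ?thesis using k by simp
  qed
  have "(\<Sum>i<n. \<Sum>j<n. X i j * U i j) = (\<Sum>i<n. \<Sum>j<n. (\<Sum>k<n. P i k * l k * P j k) * U i j)"
    using sd by (intro sum.cong refl) (auto simp: spectral_decomposition_def)
  also have "\<dots> = (\<Sum>k<n. l k * (\<Sum>i<n. \<Sum>j<n. P i k * U i j * P j k))"
    by (rule spectral_sum_expand)
  also have "\<dots> = (\<Sum>k<n. \<bar>l k\<bar>)"
    using diag by (intro sum.cong refl) (auto simp: s_def)
  finally have 1: "energy (mat n n (\<lambda>(i,j). X i j)) = (\<Sum>i<n. \<Sum>j<n. X i j * U i j)"
    using en by simp
  have "(\<Sum>i<n. U i a * U i b) = (if a = b then 1 else 0)" if ab: "a < n" "b < n" for a b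
  proof -
    have "(\<Sum>i<n. U i a * U i b) = (\<Sum>i<n. (\<Sum>h<n. P i h * (s h * P a h)) * (\<Sum>h<n. P i h * (s h * P b h)))"
      by (simp add: U_def mult_ac)
    also have "\<dots> = (\<Sum>i<n. \<Sum>h<n. \<Sum>k<n. (s h * P a h) * (s k * P b k) * (P i h * P i k))"
      by (simp add: sum_product mult_ac)
    also have "\<dots> = (\<Sum>h<n. \<Sum>i<n. \<Sum>k<n. (s h * P a h) * (s k * P b k) * (P i h * P i k))"
      by (rule sum.swap)
    also have "\<dots> = (\<Sum>h<n. \<Sum>k<n. \<Sum>i<n. (s h * P a h) * (s k * P b k) * (P i h * P i k))"
      by (intro sum.cong refl sum.swap)
    also have "\<dots> = (\<Sum>h<n. \<Sum>k<n. if h = k then (s h * P a h) * (s k * P b k) else 0)"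
      using P by (intro sum.cong refl)
        (auto simp: orthonormal_columns_def sum_distrib_left[symmetric])
    also have "\<dots> = (\<Sum>h<n. P a h * P b h)"
      by simp (intro sum.cong refl, auto simp: s_def)
    finally show ?thesis using sd ab by (simp add: spectral_decomposition_def)
  qed
  then have "orthonormal_columns n U" by (auto simp: orthonormal_columns_def)
  then show ?thesis using that 1 by blast
qed

text \<open>As a maximum of linear functionals, the energy differs between \<open>X\<close> and \<open>\<alpha> Y\<close> by at most the
largest value of \<open>\<bar>tr ((X - \<alpha> Y) U\<^sup>T)\<bar>\<close>. The Frobenius bound, which loses a factor \<open>\<surd>n\<close>, is used
for a small part \<open>F\<close>; the part \<open>b (J - I)\<close>, which comes from the mean of the adjacency matrix, is too large in Frobenius
norm but costs only \<open>2 n \<bar>b\<bar>\<close>, since \<open>J\<close> has rank one and operator norm \<open>n\<close>.\<close>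

lemma energy_compare:
  assumes X: "\<And>i j. i < n \<Longrightarrow> j < n \<Longrightarrow> X i j = X j i"
    and Y: "\<And>i j. i < n \<Longrightarrow> j < n \<Longrightarrow> Y i j = Y j i"
    and "0 \<le> \<alpha>"
    and decomp: "\<And>i j. i < n \<Longrightarrow> j < n \<Longrightarrow>
      X i j - \<alpha> * Y i j = F i j + b * (if i = j then 0 else 1)"
  shows "\<bar>energy (mat n n (\<lambda>(i,j). X i j)) - \<alpha> * energy (mat n n (\<lambda>(i,j). Y i j))\<bar>
    \<le> sqrt (\<Sum>i<n. \<Sum>j<n. (F i j)\<^sup>2) * sqrt n + 2 * \<bar>b\<bar> * n"
proof -
  let ?B = "sqrt (\<Sum>i<n. \<Sum>j<n. (F i j)\<^sup>2) * sqrt n + 2 * \<bar>b\<bar> * n"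
  have bound: "\<bar>(\<Sum>i<n. \<Sum>j<n. X i j * U i j) - \<alpha> * (\<Sum>i<n. \<Sum>j<n. Y i j * U i j)\<bar> \<le> ?B"
    if U: "orthonormal_columns n U" for U
  proof -
    have "(\<Sum>i<n. \<Sum>j<n. X i j * U i j) - \<alpha> * (\<Sum>i<n. \<Sum>j<n. Y i j * U i j)
        = (\<Sum>i<n. \<Sum>j<n. (X i j - \<alpha> * Y i j) * U i j)"
      by (simp add: sum_distrib_left sum_subtractf algebra_simps)
    also have "\<dots> = (\<Sum>i<n. \<Sum>j<n. F i j * U i j + (b * U i j - b * (if i = j then U i j else 0)))"
      by (intro sum.cong refl) (auto simp: decomp algebra_simps)
    also have "\<dots> = (\<Sum>i<n. \<Sum>j<n. F i j * U i j)
        + (b * (\<Sum>i<n. \<Sum>j<n. U i j) - b * (\<Sum>i<n. U i i))"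
      by (simp add: sum.distrib sum_subtractf sum_distrib_left[symmetric])
    finally have eq: "(\<Sum>i<n. \<Sum>j<n. X i j * U i j) - \<alpha> * (\<Sum>i<n. \<Sum>j<n. Y i j * U i j) = \<dots>" .
    have 1: "\<bar>\<Sum>i<n. \<Sum>j<n. U i j\<bar> \<le> n"
      using orthonormal_columns_bilinear[OF U, of "\<lambda>_. 1" "\<lambda>_. 1"] by simp
    have "\<bar>\<Sum>i<n. U i i\<bar> \<le> (\<Sum>i<n. \<bar>U i i\<bar>)" by (rule sum_abs)
    also have "\<dots> \<le> (\<Sum>i<n. 1)"
    proof (rule sum_mono)
      fix i assume i: "i \<in> {..<n}"
      then have "(U i i)\<^sup>2 \<le> (\<Sum>j<n. (U j i)\<^sup>2)" by (intro member_le_sum) auto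
      also have "\<dots> = 1" using U i by (simp add: orthonormal_columns_def power2_eq_square)
      finally show "\<bar>U i i\<bar> \<le> 1" by (simp add: abs_square_le_1)
    qed
    finally have 2: "\<bar>\<Sum>i<n. U i i\<bar> \<le> n" by simp
    have "\<bar>b\<bar> * \<bar>\<Sum>i<n. \<Sum>j<n. U i j\<bar> \<le> \<bar>b\<bar> * n" "\<bar>b\<bar> * \<bar>\<Sum>i<n. U i i\<bar> \<le> \<bar>b\<bar> * n"
      using 1 2 by (auto intro: mult_left_mono)
    then show ?thesis
      unfolding eq using orthonormal_columns_frobenius[OF U, of F]
      unfolding abs_mult[symmetric] by linarith
  qed
  obtain U where U: "orthonormal_columns n U"
    "energy (mat n n (\<lambda>(i,j). X i j)) = (\<Sum>i<n. \<Sum>j<n. X i j * U i j)"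
    by (rule energy_attained[of n X, OF X])
  obtain V where V: "orthonormal_columns n V"
    "energy (mat n n (\<lambda>(i,j). Y i j)) = (\<Sum>i<n. \<Sum>j<n. Y i j * V i j)"
    by (rule energy_attained[of n Y, OF Y])
  have "\<alpha> * (\<Sum>i<n. \<Sum>j<n. Y i j * U i j) \<le> \<alpha> * energy (mat n n (\<lambda>(i,j). Y i j))"
    using energy_ge_orthonormal[OF Y U(1)] \<open>0 \<le> \<alpha>\<close> by (intro mult_left_mono) auto
  moreover have "(\<Sum>i<n. \<Sum>j<n. X i j * V i j) \<le> energy (mat n n (\<lambda>(i,j). X i j))"
    by (rule energy_ge_orthonormal[OF X V(1)])
  ultimately show ?thesis using bound[OF U(1)] bound[OF V(1)] U(2) V(2) by (simp add: abs_le_iff)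
qed

section \<open>Resolvents and their response to one edge\<close>

text \<open>The properties of \<open>(X - i t)\<inverse>\<close> that the perturbation argument needs: symmetry, the resolvent
equation, and the entrywise and row bounds that follow from the operator norm bound \<open>1/t\<close>.\<close>

definition is_resolvent :: "nat \<Rightarrow> (nat \<Rightarrow> nat \<Rightarrow> real) \<Rightarrow> real \<Rightarrow> (nat \<Rightarrow> nat \<Rightarrow> complex) \<Rightarrow> bool" where
  "is_resolvent n X t G \<longleftrightarrow>
     (\<forall>i<n. \<forall>j<n. G i j = G j i) \<and>
     (\<forall>i<n. \<forall>m<n. (\<Sum>j<n. complex_of_real (X i j) * G j m) = (if i = m then 1 else 0) + \<i> * t * G i m) \<and>
     (\<forall>i<n. \<forall>j<n. cmod (G i j) \<le> 1 / t) \<and>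
     (\<forall>i<n. (\<Sum>j<n. (cmod (G i j))\<^sup>2) \<le> 1 / t\<^sup>2)"

lemma is_resolventD:
  assumes "is_resolvent n X t G"
  shows is_resolvent_sym: "i < n \<Longrightarrow> j < n \<Longrightarrow> G i j = G j i"
    and is_resolvent_eq: "i < n \<Longrightarrow> m < n \<Longrightarrow>
      (\<Sum>j<n. complex_of_real (X i j) * G j m) = (if i = m then 1 else 0) + \<i> * t * G i m"
    and is_resolvent_bound: "i < n \<Longrightarrow> j < n \<Longrightarrow> cmod (G i j) \<le> 1 / t"
    and is_resolvent_row: "i < n \<Longrightarrow> (\<Sum>j<n. (cmod (G i j))\<^sup>2) \<le> 1 / t\<^sup>2"
  using assms unfolding is_resolvent_def by blast+

lemma is_resolvent_column:
  assumes "is_resolvent n X t G" "i < n"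
  shows "(\<Sum>j<n. (cmod (G j i))\<^sup>2) \<le> 1 / t\<^sup>2"
proof -
  have "(\<Sum>j<n. (cmod (G j i))\<^sup>2) = (\<Sum>j<n. (cmod (G i j))\<^sup>2)"
    by (rule sum.cong[OF refl]) (use is_resolvent_sym[OF assms(1)] assms(2) in \<open>metis lessThan_iff\<close>)
  then show ?thesis using is_resolvent_row[OF assms] by simp
qed

definition norm_trace :: "nat \<Rightarrow> (nat \<Rightarrow> nat \<Rightarrow> complex) \<Rightarrow> complex" where
  "norm_trace n G = (\<Sum>i<n. G i i) / of_nat n"

text \<open>The Stieltjes transform of the semicircle law satisfies \<open>1 + z m + m\<^sup>2 = 0\<close>; here \<open>z = i t\<close>.\<close>

definition semicircle_defect :: "nat \<Rightarrow> real \<Rightarrow> (nat \<Rightarrow> nat \<Rightarrow> complex) \<Rightarrow> complex" where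
  "semicircle_defect n t G = 1 + \<i> * t * norm_trace n G + (norm_trace n G)\<^sup>2"

definition spectral_resolvent ::
    "nat \<Rightarrow> (nat \<Rightarrow> nat \<Rightarrow> real) \<Rightarrow> (nat \<Rightarrow> real) \<Rightarrow> real \<Rightarrow> nat \<Rightarrow> nat \<Rightarrow> complex" where
  "spectral_resolvent n P l t i j = (\<Sum>k<n. of_real (P i k * P j k) / (of_real (l k) - \<i> * of_real t))"

lemma cmod_real_minus_it:
  assumes "0 < t"
  shows "t \<le> cmod (of_real x - \<i> * of_real t)"
  using abs_Im_le_cmod[of "of_real x - \<i> * of_real t"] assms by simp

text \<open>All bounds reduce to \<open>\<bar>\<lambda> - i t\<bar> \<ge> t\<close> for real \<open>\<lambda>\<close>.\<close>

lemma spectral_resolvent_is_resolvent: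
  assumes sd: "spectral_decomposition n X P l" and t: "0 < t"
  shows "is_resolvent n X t (spectral_resolvent n P l t)"
proof -
  let ?G = "spectral_resolvent n P l t"
  define r where "r k = 1 / (complex_of_real (l k) - \<i> * of_real t)" for k
  have nz: "complex_of_real (l k) - \<i> * of_real t \<noteq> 0" for k
    using cmod_real_minus_it[OF t, of "l k"] t by auto
  have r: "cmod (r k) \<le> 1 / t" for k
    unfolding r_def norm_divide norm_one
    using cmod_real_minus_it[OF t, of "l k"] t by (intro divide_left_mono) auto
  have G: "?G i j = (\<Sum>k<n. of_real (P i k * P j k) * r k)" for i j
    by (simp add: spectral_resolvent_def r_def)
  have cols: "(\<Sum>i<n. P i k * P i h) = (if k = h then 1 else 0)" if "k < n" "h < n" for k h
    using sd that by (simp add: spectral_decomposition_def)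
  have rows: "(\<Sum>k<n. P i k * P j k) = (if i = j then 1 else 0)" if "i < n" "j < n" for i j
    using sd that by (simp add: spectral_decomposition_def)
  have sym: "?G i j = ?G j i" for i j by (simp add: G mult.commute)
  have XP: "(\<Sum>j<n. X i j * P j k) = l k * P i k" if "i < n" "k < n" for i k
  proof -
    have "(\<Sum>j<n. X i j * P j k) = (\<Sum>j<n. \<Sum>h<n. P i h * l h * (P j h * P j k))"
      using sd that
      by (intro sum.cong refl) (simp add: spectral_decomposition_def sum_distrib_right sum_distrib_left mult_ac)
    also have "\<dots> = (\<Sum>h<n. \<Sum>j<n. P i h * l h * (P j h * P j k))" by (rule sum.swap)
    also have "\<dots> = (\<Sum>h<n. if h = k then P i h * l h else 0)"
      using cols that by (intro sum.cong refl) (auto simp: sum_distrib_left[symmetric])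
    finally show ?thesis using that by simp
  qed
  have res: "(\<Sum>j<n. complex_of_real (X i j) * ?G j m) = (if i = m then 1 else 0) + \<i> * t * ?G i m"
    if im: "i < n" "m < n" for i m
  proof -
    have "(\<Sum>j<n. complex_of_real (X i j) * ?G j m)
        = (\<Sum>j<n. \<Sum>k<n. of_real (X i j * P j k) * (of_real (P m k) * r k))"
      by (simp add: G sum_distrib_left mult_ac)
    also have "\<dots> = (\<Sum>k<n. \<Sum>j<n. of_real (X i j * P j k) * (of_real (P m k) * r k))"
      by (rule sum.swap)
    also have "\<dots> = (\<Sum>k<n. of_real (\<Sum>j<n. X i j * P j k) * (of_real (P m k) * r k))"
      by (simp add: sum_distrib_right)
    also have "\<dots> = (\<Sum>k<n. of_real (P i k * P m k) + \<i> * t * (of_real (P i k * P m k) * r k))"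
    proof (intro sum.cong refl)
      fix k assume "k \<in> {..<n}"
      moreover have "of_real (l k) * r k = 1 + \<i> * t * r k"
        using nz[of k] by (simp add: r_def field_simps)
      then have "of_real (l k * P i k) * (of_real (P m k) * r k)
          = of_real (P i k * P m k) * (1 + \<i> * t * r k)" by (simp add: mult_ac)
      ultimately show "of_real (\<Sum>j<n. X i j * P j k) * (of_real (P m k) * r k)
          = of_real (P i k * P m k) + \<i> * t * (of_real (P i k * P m k) * r k)"
        using XP[OF im(1), of k] by (simp add: algebra_simps)
    qed
    also have "\<dots> = of_real (\<Sum>k<n. P i k * P m k) + \<i> * t * ?G i m"
      by (simp add: sum.distrib G sum_distrib_left)
    finally show ?thesis using rows[OF im] by simp
  qed
  have bound: "cmod (?G i j) \<le> 1 / t" if ij: "i < n" "j < n" for i j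
  proof -
    have "cmod (?G i j) \<le> (\<Sum>k<n. \<bar>P i k\<bar> * \<bar>P j k\<bar> * (1 / t))"
      unfolding G
    proof (intro sum_norm_le)
      fix k
      have "\<bar>P i k\<bar> * \<bar>P j k\<bar> * cmod (r k) \<le> \<bar>P i k\<bar> * \<bar>P j k\<bar> * (1 / t)"
        by (intro mult_left_mono r) auto
      then show "cmod (of_real (P i k * P j k) * r k) \<le> \<bar>P i k\<bar> * \<bar>P j k\<bar> * (1 / t)"
        by (simp add: norm_mult abs_mult)
    qed
    also have "\<dots> = (\<Sum>k<n. \<bar>P i k\<bar> * \<bar>P j k\<bar>) * (1 / t)" by (simp only: sum_distrib_right)
    also have "\<dots> \<le> (L2_set (P i) {..<n} * L2_set (P j) {..<n}) * (1 / t)"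
      using t by (intro mult_right_mono L2_set_mult_ineq) auto
    also have "\<dots> = 1 / t" using rows ij by (simp add: L2_set_def power2_eq_square)
    finally show ?thesis .
  qed
  have rowbound: "(\<Sum>j<n. (cmod (?G i j))\<^sup>2) \<le> 1 / t\<^sup>2" if i: "i < n" for i
  proof -
    have "complex_of_real (\<Sum>j<n. (cmod (?G i j))\<^sup>2) = (\<Sum>j<n. ?G i j * cnj (?G i j))"
      by (simp add: complex_norm_square del: of_real_power)
    also have "\<dots> = (\<Sum>j<n. \<Sum>k<n. \<Sum>h<n. of_real (P i k * P i h) * r k * cnj (r h) * of_real (P j k * P j h))"
      by (simp add: G sum_product mult_ac)
    also have "\<dots> = (\<Sum>k<n. \<Sum>j<n. \<Sum>h<n. of_real (P i k * P i h) * r k * cnj (r h) * of_real (P j k * P j h))"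
      by (rule sum.swap)
    also have "\<dots> = (\<Sum>k<n. \<Sum>h<n. \<Sum>j<n. of_real (P i k * P i h) * r k * cnj (r h) * of_real (P j k * P j h))"
      by (intro sum.cong refl sum.swap)
    also have "\<dots> = (\<Sum>k<n. \<Sum>h<n. of_real (P i k * P i h) * r k * cnj (r h) * of_real (\<Sum>j<n. P j k * P j h))"
      by (simp add: sum_distrib_left)
    also have "\<dots> = (\<Sum>k<n. \<Sum>h<n. if k = h then of_real (P i k * P i k) * (r k * cnj (r k)) else 0)"
      using cols by (intro sum.cong refl) auto
    also have "\<dots> = (\<Sum>k<n. of_real (P i k * P i k) * (r k * cnj (r k)))" by simp
    also have "\<dots> = (\<Sum>k<n. of_real ((P i k)\<^sup>2 * (cmod (r k))\<^sup>2))"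
      by (simp only: of_real_mult complex_norm_square power2_eq_square[of "P i _"])
    finally have "complex_of_real (\<Sum>j<n. (cmod (?G i j))\<^sup>2) = complex_of_real (\<Sum>k<n. (P i k)\<^sup>2 * (cmod (r k))\<^sup>2)"
      by simp
    then have "(\<Sum>j<n. (cmod (?G i j))\<^sup>2) = (\<Sum>k<n. (P i k)\<^sup>2 * (cmod (r k))\<^sup>2)"
      unfolding of_real_eq_iff .
    also have "\<dots> \<le> (\<Sum>k<n. (P i k)\<^sup>2 * (1 / t)\<^sup>2)"
      by (intro sum_mono mult_left_mono power_mono r) auto
    also have "\<dots> = 1 / t\<^sup>2"
      using rows[OF i i] by (simp add: sum_divide_distrib[symmetric] power2_eq_square)
    finally show ?thesis .
  qed
  show ?thesis unfolding is_resolvent_def using sym res bound rowbound by blast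
qed

lemma trace_spectral_resolvent:
  assumes "spectral_decomposition n X P l"
  shows "(\<Sum>i<n. spectral_resolvent n P l t i i) = (\<Sum>k<n. 1 / (of_real (l k) - \<i> * of_real t))"
proof -
  have "(\<Sum>i<n. spectral_resolvent n P l t i i) =
      (\<Sum>k<n. \<Sum>i<n. of_real (P i k * P i k) / (of_real (l k) - \<i> * of_real t))"
    unfolding spectral_resolvent_def by (rule sum.swap)
  also have "\<dots> = (\<Sum>k<n. of_real (\<Sum>i<n. P i k * P i k) / (of_real (l k) - \<i> * of_real t))"
    by (simp add: sum_divide_distrib)
  also have "\<dots> = (\<Sum>k<n. 1 / (of_real (l k) - \<i> * of_real t))"
    using assms by (intro sum.cong refl)
      (simp add: spectral_decomposition_def del: of_real_sum of_real_mult)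
  finally show ?thesis .
qed

text \<open>\<open>G' - G = G ((X - i t) - (X' - i t)) G'\<close>, written out in entries.\<close>

lemma resolvent_identity:
  assumes G: "is_resolvent n X t G" and G': "is_resolvent n X' t G'"
    and sym: "\<And>i j. i < n \<Longrightarrow> j < n \<Longrightarrow> X i j = X j i" and ab: "a < n" "b < n"
  shows "G' a b - G a b = (\<Sum>i<n. \<Sum>j<n. G a i * of_real (X i j - X' i j) * G' j b)"
proof -
  have "(\<Sum>i<n. \<Sum>j<n. G a i * of_real (X i j) * G' j b)
      = (\<Sum>j<n. \<Sum>i<n. G a i * of_real (X i j) * G' j b)" by (rule sum.swap)
  also have "\<dots> = (\<Sum>j<n. (\<Sum>i<n. of_real (X j i) * G i a) * G' j b)"
  proof (intro sum.cong refl)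
    fix j assume j: "j \<in> {..<n}"
    show "(\<Sum>i<n. G a i * of_real (X i j) * G' j b) = (\<Sum>i<n. of_real (X j i) * G i a) * G' j b"
      unfolding sum_distrib_right
    proof (intro sum.cong refl)
      fix i assume i: "i \<in> {..<n}"
      have "X i j = X j i" using sym i j by simp
      moreover have "G a i = G i a" using is_resolvent_sym[OF G] ab i by simp
      ultimately show "G a i * of_real (X i j) * G' j b = of_real (X j i) * G i a * G' j b"
        by (simp only: mult.commute)
    qed
  qed
  also have "\<dots> = (\<Sum>j<n. (if j = a then G' j b else 0) + \<i> * t * (G a j * G' j b))"
  proof (intro sum.cong refl)
    fix j assume "j \<in> {..<n}"
    then have "(\<Sum>i<n. of_real (X j i) * G i a) = (if j = a then 1 else 0) + \<i> * t * G a j"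
      using is_resolvent_eq[OF G, of j a] is_resolvent_sym[OF G, of j a] ab by simp
    then show "(\<Sum>i<n. of_real (X j i) * G i a) * G' j b = (if j = a then G' j b else 0) + \<i> * t * (G a j * G' j b)"
      by (simp add: algebra_simps)
  qed
  also have "\<dots> = G' a b + \<i> * t * (\<Sum>j<n. G a j * G' j b)"
    using ab by (simp add: sum.distrib sum_distrib_left)
  finally have 1: "(\<Sum>i<n. \<Sum>j<n. G a i * of_real (X i j) * G' j b) = \<dots>" .
  have "(\<Sum>i<n. \<Sum>j<n. G a i * of_real (X' i j) * G' j b)
      = (\<Sum>i<n. G a i * (\<Sum>j<n. of_real (X' i j) * G' j b))"
    by (simp add: sum_distrib_left mult.assoc)
  also have "\<dots> = (\<Sum>i<n. (if i = b then G a i else 0) + \<i> * t * (G a i * G' i b))"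
    using ab by (intro sum.cong refl) (auto simp: is_resolvent_eq[OF G'] distrib_left mult.left_commute)
  also have "\<dots> = G a b + \<i> * t * (\<Sum>i<n. G a i * G' i b)"
    using ab by (simp add: sum.distrib sum_distrib_left)
  finally have 2: "(\<Sum>i<n. \<Sum>j<n. G a i * of_real (X' i j) * G' j b) = \<dots>" .
  have "(\<Sum>i<n. \<Sum>j<n. G a i * of_real (X i j - X' i j) * G' j b) =
      (\<Sum>i<n. \<Sum>j<n. G a i * of_real (X i j) * G' j b) - (\<Sum>i<n. \<Sum>j<n. G a i * of_real (X' i j) * G' j b)"
    by (simp add: left_diff_distrib right_diff_distrib sum_subtractf)
  then show ?thesis unfolding 1 2 by simp
qed

text \<open>The effect of changing one symmetric pair of entries by \<open>d\<close>: entries of the resolvent move by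
\<open>O(d)\<close>, but the normalized trace moves only by \<open>O(d/n)\<close>, because the perturbation has rank two.\<close>

locale entry_perturbation =
  fixes n :: nat and X X' :: "nat \<Rightarrow> nat \<Rightarrow> real" and i j :: nat and d t :: real
    and G G' :: "nat \<Rightarrow> nat \<Rightarrow> complex"
  assumes G: "is_resolvent n X t G" and G': "is_resolvent n X' t G'"
    and sym: "\<And>i j. i < n \<Longrightarrow> j < n \<Longrightarrow> X i j = X j i"
    and ij: "i < n" "j < n" "i \<noteq> j" and t: "0 < t"
    and pert: "\<And>u v. u < n \<Longrightarrow> v < n \<Longrightarrow>
      X u v - X' u v = (if (u = i \<and> v = j) \<or> (u = j \<and> v = i) then d else 0)"
begin

lemma resolvent_diff:
  assumes "a < n" "b < n"
  shows "G' a b - G a b = d * (G a i * G' j b + G a j * G' i b)"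
proof -
  have "G' a b - G a b = (\<Sum>u<n. \<Sum>v<n. G a u * of_real (X u v - X' u v) * G' v b)"
    by (rule resolvent_identity[OF G G' sym assms])
  also have "\<dots> = (\<Sum>u<n. \<Sum>v<n. (if v = j then if u = i then d * (G a i * G' j b) else 0 else 0)
      + (if v = i then if u = j then d * (G a j * G' i b) else 0 else 0))"
    using ij by (intro sum.cong refl) (auto simp: pert mult_ac)
  also have "\<dots> = d * (G a i * G' j b) + d * (G a j * G' i b)"
    using ij by (simp add: sum.distrib)
  finally show ?thesis by (simp add: algebra_simps)
qed

lemma bounds: "a < n \<Longrightarrow> b < n \<Longrightarrow> cmod (G a b) \<le> 1 / t" "a < n \<Longrightarrow> b < n \<Longrightarrow> cmod (G' a b) \<le> 1 / t"
  using is_resolvent_bound[OF G] is_resolvent_bound[OF G'] by auto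

lemma resolvent_diff_le:
  assumes ab: "a < n" "b < n"
  shows "cmod (G' a b - G a b) \<le> \<bar>d\<bar> * (2 / t\<^sup>2)"
proof -
  have "cmod (G a i * G' j b + G a j * G' i b) \<le> 1/t * (1/t) + 1/t * (1/t)"
    using ab ij t by (intro norm_triangle_le add_mono; simp only: norm_mult)
      (intro mult_mono bounds; simp)+
  then have "\<bar>d\<bar> * cmod (G a i * G' j b + G a j * G' i b) \<le> \<bar>d\<bar> * (2 / t\<^sup>2)"
    by (intro mult_left_mono) (auto simp: power2_eq_square)
  then show ?thesis by (simp add: resolvent_diff[OF ab] norm_mult)
qed

lemma column_products_le:
  assumes "a < n" "b < n"
  shows "(\<Sum>k<n. cmod (G k a) * cmod (G' b k)) \<le> 1 / t\<^sup>2"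
proof -
  note 1 = is_resolvent_column[OF G assms(1)] and 2 = is_resolvent_row[OF G' assms(2)]
  have "(\<Sum>k<n. cmod (G k a) * cmod (G' b k)) \<le> (\<Sum>k<n. ((cmod (G k a))\<^sup>2 + (cmod (G' b k))\<^sup>2) / 2)"
  proof (rule sum_mono)
    fix k
    show "cmod (G k a) * cmod (G' b k) \<le> ((cmod (G k a))\<^sup>2 + (cmod (G' b k))\<^sup>2) / 2"
      using sum_squares_bound[of "cmod (G k a)" "cmod (G' b k)"] by simp
  qed
  also have "\<dots> \<le> 1 / t\<^sup>2"
    using 1 2 by (simp add: sum_divide_distrib[symmetric] sum.distrib)
  finally show ?thesis .
qed

lemma norm_trace_diff_le:
  "cmod (norm_trace n G' - norm_trace n G) \<le> \<bar>d\<bar> * (2 / t\<^sup>2) / n"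
proof -
  have "cmod (\<Sum>a<n. G' a a - G a a) \<le> (\<Sum>a<n. \<bar>d\<bar> * (cmod (G a i) * cmod (G' j a) + cmod (G a j) * cmod (G' i a)))"
    by (intro sum_norm_le)
      (auto simp: resolvent_diff norm_mult intro!: mult_left_mono norm_triangle_le)
  also have "\<dots> = \<bar>d\<bar> * ((\<Sum>a<n. cmod (G a i) * cmod (G' j a)) + (\<Sum>a<n. cmod (G a j) * cmod (G' i a)))"
    by (simp add: sum_distrib_left sum.distrib distrib_left)
  also have "\<dots> \<le> \<bar>d\<bar> * (1 / t\<^sup>2 + 1 / t\<^sup>2)"
    using ij by (intro mult_left_mono add_mono column_products_le) auto
  finally have "cmod (\<Sum>a<n. G' a a - G a a) \<le> \<bar>d\<bar> * (2 / t\<^sup>2)" by simp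
  then have "cmod (\<Sum>a<n. G' a a - G a a) / n \<le> \<bar>d\<bar> * (2 / t\<^sup>2) / n"
    by (intro divide_right_mono) auto
  then show ?thesis
    by (simp add: norm_trace_def diff_divide_distrib[symmetric] sum_subtractf norm_divide)
qed

end

lemma norm_trace_le:
  assumes "is_resolvent n X t G" "0 < t"
  shows "cmod (norm_trace n G) \<le> 1 / t"
proof (cases "n = 0")
  case False
  have "cmod (\<Sum>i<n. G i i) \<le> (\<Sum>i<n. 1 / t)"
    using is_resolvent_bound[OF assms(1)] by (intro sum_norm_le) auto
  then have "cmod (\<Sum>i<n. G i i) / n \<le> (n * (1 / t)) / n" by (intro divide_right_mono) auto
  then show ?thesis using False by (simp add: norm_trace_def norm_divide)
qed (use assms in \<open>simp add: norm_trace_def\<close>)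

lemma semicircle_defect_le:
  assumes "is_resolvent n X t G" "0 < t"
  shows "cmod (semicircle_defect n t G) \<le> 2 + 1 / t\<^sup>2"
proof -
  note m = norm_trace_le[OF assms]
  have "cmod (\<i> * t * norm_trace n G) \<le> t * (1 / t)"
    using m assms(2) by (simp add: norm_mult mult_left_mono del: times_divide_eq_right)
  moreover have "cmod ((norm_trace n G)\<^sup>2) \<le> (1 / t)\<^sup>2"
    unfolding norm_power by (intro power_mono m) auto
  moreover have "cmod (semicircle_defect n t G) \<le> cmod 1 + cmod (\<i> * t * norm_trace n G) + cmod ((norm_trace n G)\<^sup>2)"
    unfolding semicircle_defect_def by (rule order_trans[OF norm_triangle_ineq add_right_mono[OF norm_triangle_ineq]])
  ultimately show ?thesis using assms(2) by (simp add: power_divide)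
qed

lemma (in entry_perturbation) semicircle_defect_diff_le:
  "cmod (semicircle_defect n t G' - semicircle_defect n t G) \<le> (t + 2 / t) * (\<bar>d\<bar> * (2 / t\<^sup>2) / n)"
proof -
  let ?m = "norm_trace n G" and ?m' = "norm_trace n G'"
  have "semicircle_defect n t G' - semicircle_defect n t G = (\<i> * t + ?m + ?m') * (?m' - ?m)"
    by (simp add: semicircle_defect_def power2_eq_square algebra_simps)
  moreover have "cmod (\<i> * t + ?m + ?m') \<le> t + 1 / t + 1 / t"
    using norm_trace_le[OF G t] norm_trace_le[OF G' t] t
    by (intro norm_triangle_le add_mono) (auto simp: norm_mult)
  then have "cmod ((\<i> * t + ?m + ?m') * (?m' - ?m)) \<le> (t + 1 / t + 1 / t) * (\<bar>d\<bar> * (2 / t\<^sup>2) / n)"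
    unfolding norm_mult using t by (intro mult_mono norm_trace_diff_le) auto
  ultimately show ?thesis by (simp add: add.commute)
qed

lemma triple_product_diff_le:
  fixes a b z :: complex
  assumes "cmod a \<le> r" "cmod b \<le> r" "cmod a' \<le> r" "cmod b' \<le> r" "cmod z \<le> B" "cmod z' \<le> B"
    and "cmod (a - a') \<le> \<epsilon>" "cmod (b - b') \<le> \<epsilon>" "cmod (z - z') \<le> \<epsilon>"
  shows "cmod (a * b * z - a' * b' * z') \<le> \<epsilon> * (2 * r * B + r\<^sup>2)"
proof -
  have r: "0 \<le> r" using order_trans[OF norm_ge_zero assms(1)] .
  have B: "0 \<le> B" using order_trans[OF norm_ge_zero assms(5)] .
  have e: "0 \<le> \<epsilon>" using order_trans[OF norm_ge_zero assms(7)] .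
  have "a * b * z - a' * b' * z' = (a - a') * b * z + a' * (b - b') * z + a' * b' * (z - z')"
    by (simp add: algebra_simps)
  then have "cmod (a * b * z - a' * b' * z') \<le>
      cmod ((a - a') * b * z) + cmod (a' * (b - b') * z) + cmod (a' * b' * (z - z'))"
    by (simp only: order_trans[OF norm_triangle_ineq add_right_mono[OF norm_triangle_ineq]])
  also have "\<dots> \<le> \<epsilon> * r * B + r * \<epsilon> * B + r * r * \<epsilon>"
    unfolding norm_mult
    by (intro add_mono mult_mono assms mult_nonneg_nonneg norm_ge_zero r B e)
  finally show ?thesis by (simp add: algebra_simps power2_eq_square)
qed

text \<open>\<open>flip_constant t * c\<close> bounds the change of a resolvent entry when an entry pair of the matrix
changes by \<open>c\<close>, and the same quantity divided by \<open>n\<close> bounds the change of the defect.\<close>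

definition flip_constant :: "real \<Rightarrow> real" where
  "flip_constant t = (1 + t + 2 / t) * (2 / t\<^sup>2)"

text \<open>The first term pays for replacing all factors in the two products of three by those of one matrix,
the second for the variation of the defect itself.\<close>

definition flip_error :: "nat \<Rightarrow> real \<Rightarrow> real \<Rightarrow> real" where
  "flip_error n t c = 2 * (flip_constant t * c) * (2 * (1 / t) * (2 + 1 / t\<^sup>2) + (1 / t)\<^sup>2)
      + flip_constant t / (t * n)"

text \<open>The finite difference of \<open>G\<^sub>j\<^sub>i cnj(Y)\<close> across one flip is \<open>-c\<close> times \<open>(G\<^sub>j\<^sub>j G\<^sub>i\<^sub>i + G\<^sub>j\<^sub>i\<^sup>2) cnj(Y)\<close> up to
smaller terms. The exact difference mixes \<open>G0\<close> and \<open>G1\<close>; each factor may be replaced by that of the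
matrix actually present, and the variation of \<open>cnj(Y)\<close> is smaller by a factor \<open>n\<close>.\<close>

lemma entry_flip:
  fixes n i j :: nat and c t :: real
  assumes G1: "is_resolvent n X1 t G1" and G0: "is_resolvent n X0 t G0"
    and G: "G = G0 \<or> G = G1"
    and sym: "\<And>i j. i < n \<Longrightarrow> j < n \<Longrightarrow> X0 i j = X0 j i"
    and ij: "i < n" "j < n" "i \<noteq> j" and t: "0 < t" and c: "0 < c"
    and pert: "\<And>u v. u < n \<Longrightarrow> v < n \<Longrightarrow>
      X1 u v - X0 u v = (if (u = i \<and> v = j) \<or> (u = j \<and> v = i) then c else 0)"
  shows "cmod ((G1 j i * cnj (semicircle_defect n t G1) - G0 j i * cnj (semicircle_defect n t G0))
      + c * ((G j j * G i i + G j i * G j i) * cnj (semicircle_defect n t G)))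
    \<le> c * flip_error n t c"
proof -
  have n: "real n \<ge> 1" using ij by simp
  interpret p: entry_perturbation n X0 X1 i j "-c" t G0 G1
    using assms by unfold_locales (auto simp: field_simps split: if_splits)
  let ?L = "flip_constant t"
  define Z where "Z H = cnj (semicircle_defect n t H)" for H
  have L: "?L > 0" using t by (simp add: flip_constant_def add_pos_pos)
  have dG: "cmod (G1 a b - G0 a b) \<le> ?L * c" if "a < n" "b < n" for a b
  proof -
    have "cmod (G1 a b - G0 a b) \<le> c * (1 * (2 / t\<^sup>2))" using p.resolvent_diff_le[OF that] c by simp
    also have "\<dots> \<le> c * ?L" unfolding flip_constant_def
      using t c by (intro mult_left_mono mult_right_mono) auto
    finally show ?thesis by (simp add: mult.commute)
  qed
  have dZ: "cmod (Z G1 - Z G0) \<le> ?L * c / n"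
  proof -
    have "cmod (Z G1 - Z G0) = cmod (semicircle_defect n t G1 - semicircle_defect n t G0)"
      by (simp only: Z_def complex_cnj_diff[symmetric] complex_mod_cnj)
    also have "\<dots> \<le> (t + 2 / t) * (2 / t\<^sup>2) * c / n" using p.semicircle_defect_diff_le c
      by (simp add: mult_ac)
    also have "\<dots> \<le> ?L * c / n" unfolding flip_constant_def
      using t c by (intro divide_right_mono mult_right_mono) auto
    finally show ?thesis .
  qed
  have "?L * c / n \<le> ?L * c / 1" using n L c by (intro divide_left_mono) auto
  then have dZ': "cmod (Z G1 - Z G0) \<le> ?L * c" using dZ by linarith
  have bG: "cmod (H a b) \<le> 1 / t" if "H = G0 \<or> H = G1" "a < n" "b < n" for H a b
    using that p.bounds by auto
  have bZ: "cmod (Z H) \<le> 2 + 1 / t\<^sup>2" if "H = G0 \<or> H = G1" for H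
    using that semicircle_defect_le[OF G0 t] semicircle_defect_le[OF G1 t] by (auto simp: Z_def)
  have dGG: "cmod (H a b - H' a b) \<le> ?L * c" if "H = G0 \<or> H = G1" "H' = G0 \<or> H' = G1" "a < n" "b < n" for H H' a b
    using that dG[of a b] L c by (auto simp: norm_minus_commute)
  have dZZ: "cmod (Z H - Z H') \<le> ?L * c" if "H = G0 \<or> H = G1" "H' = G0 \<or> H' = G1" for H H'
    using that dZ' L c by (auto simp: norm_minus_commute)
  let ?T = "?L * c * (2 * (1 / t) * (2 + 1 / t\<^sup>2) + (1 / t)\<^sup>2)"
  have 1: "cmod (G j i * G j i * Z G - G0 j i * G1 j i * Z G1) \<le> ?T"
    by (rule triple_product_diff_le[OF bG[of G j i] bG[of G j i] bG[of G0 j i] bG[of G1 j i]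
          bZ[of G] bZ[of G1] dGG[of G G0 j i] dGG[of G G1 j i] dZZ[of G G1]])
      (use G ij in simp_all)
  have 2: "cmod (G j j * G i i * Z G - G0 j j * G1 i i * Z G1) \<le> ?T"
    by (rule triple_product_diff_le[OF bG[of G j j] bG[of G i i] bG[of G0 j j] bG[of G1 i i]
          bZ[of G] bZ[of G1] dGG[of G G0 j j] dGG[of G G1 i i] dZZ[of G G1]])
      (use G ij in simp_all)
  have 3: "cmod (G0 j i * (Z G1 - Z G0)) \<le> 1 / t * (?L * c / n)"
    unfolding norm_mult using bG[of G0 j i] ij dZ t by (intro mult_mono) auto
  let ?E = "G0 j i * G1 j i + G0 j j * G1 i i"
  have diff: "G1 j i - G0 j i = - c * ?E"
    using p.resolvent_diff[of j i] ij by simp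
  have "G1 j i * Z G1 - G0 j i * Z G0 = (G1 j i - G0 j i) * Z G1 + G0 j i * (Z G1 - Z G0)"
    by (simp add: algebra_simps)
  also have "\<dots> = - c * ?E * Z G1 + G0 j i * (Z G1 - Z G0)" unfolding diff ..
  finally have "(G1 j i * Z G1 - G0 j i * Z G0) + c * ((G j j * G i i + G j i * G j i) * Z G)
     = (- c * ?E * Z G1 + G0 j i * (Z G1 - Z G0)) + c * ((G j j * G i i + G j i * G j i) * Z G)"
    by (rule arg_cong)
  also have "\<dots> = c * ((G j i * G j i * Z G - G0 j i * G1 j i * Z G1) + (G j j * G i i * Z G - G0 j j * G1 i i * Z G1))
       + G0 j i * (Z G1 - Z G0)"
    by (simp add: algebra_simps)
  finally have "cmod ((G1 j i * Z G1 - G0 j i * Z G0) + c * ((G j j * G i i + G j i * G j i) * Z G)) = cmod \<dots>"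
    by (rule arg_cong)
  also have "\<dots> \<le> c * (?T + ?T) + 1 / t * (?L * c / n)"
  proof (intro norm_triangle_le add_mono 3)
    have "cmod ((G j i * G j i * Z G - G0 j i * G1 j i * Z G1) + (G j j * G i i * Z G - G0 j j * G1 i i * Z G1)) \<le> ?T + ?T"
      by (intro norm_triangle_le add_mono 1 2)
    then show "cmod (c * ((G j i * G j i * Z G - G0 j i * G1 j i * Z G1) + (G j j * G i i * Z G - G0 j j * G1 i i * Z G1))) \<le> c * (?T + ?T)"
      unfolding norm_mult using c by (simp only: norm_of_real abs_of_pos) (intro mult_left_mono; simp)
  qed
  also have "\<dots> = c * flip_error n t c" by (simp add: flip_error_def ring_distribs mult_ac)
  finally show ?thesis unfolding Z_def .
qed

text \<open>Summing the diagonal of the resolvent equation gives \<open>1 + i t m = (1/n) \<Sum> X\<^sub>i\<^sub>j G\<^sub>j\<^sub>i\<close>, and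
\<open>m\<^sup>2 = (1/n\<^sup>2) \<Sum> G\<^sub>j\<^sub>j G\<^sub>i\<^sub>i\<close>. The added squares \<open>G\<^sub>j\<^sub>i\<^sup>2\<close> and the omitted diagonal are \<open>O(1/n)\<close> by the
entry and row bounds; they are included in \<open>S\<close> to match the terms produced by flipping an edge.\<close>

lemma defect_expansion:
  assumes G: "is_resolvent n X t G" and t: "0 < t" and n: "0 < n"
    and diag: "\<And>i. i < n \<Longrightarrow> X i i = 0"
  defines "S \<equiv> \<Sum>i<n. \<Sum>j<n. if i = j then 0 else
     of_real (X i j) * G j i + of_real (1 / n) * (G j j * G i i + G j i * G j i)"
  shows "cmod (semicircle_defect n t G - S / n) \<le> 3 / (t\<^sup>2 * n)"
proof -
  let ?N = "of_nat n :: complex"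
  have XG: "(\<Sum>i<n. \<Sum>j<n. of_real (X i j) * G j i) = ?N + \<i> * t * (\<Sum>i<n. G i i)"
  proof -
    have "(\<Sum>i<n. \<Sum>j<n. of_real (X i j) * G j i) = (\<Sum>i<n. 1 + \<i> * t * G i i)"
      by (intro sum.cong refl) (simp add: is_resolvent_eq[OF G])
    then show ?thesis by (simp add: sum.distrib sum_distrib_left)
  qed
  have GG: "(\<Sum>i<n. \<Sum>j<n. G j j * G i i) = (\<Sum>i<n. G i i)\<^sup>2"
    by (simp add: power2_eq_square sum_product mult.commute)
  have "S = (\<Sum>i<n. \<Sum>j<n. (of_real (X i j) * G j i + of_real (1 / n) * (G j j * G i i) + of_real (1 / n) * (G j i * G j i))
      - (if i = j then of_real (2 / n) * (G i i * G i i) else 0))"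
    unfolding S_def using diag by (intro sum.cong refl) (auto simp: algebra_simps)
  also have "\<dots> = (\<Sum>i<n. \<Sum>j<n. of_real (X i j) * G j i) + of_real (1 / n) * (\<Sum>i<n. \<Sum>j<n. G j j * G i i)
      + of_real (1 / n) * (\<Sum>i<n. \<Sum>j<n. G j i * G j i) - of_real (2 / n) * (\<Sum>i<n. G i i * G i i)"
    by (simp add: sum.distrib sum_subtractf sum_distrib_left)
  finally have S: "S = ?N + \<i> * t * (\<Sum>i<n. G i i) + of_real (1 / n) * (\<Sum>i<n. G i i)\<^sup>2
      + of_real (1 / n) * (\<Sum>i<n. \<Sum>j<n. G j i * G j i) - of_real (2 / n) * (\<Sum>i<n. G i i * G i i)"
    unfolding XG GG .
  (* T, Q and R stand for the trace, the sum of all squares and the sum of the diagonal squares *)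
  have algebra: "1 + z * (T / N) + (T / N)\<^sup>2 - (N + z * T + 1 / N * T\<^sup>2 + 1 / N * Q - 2 / N * R) / N
      = - ((Q - 2 * R) / N\<^sup>2)" if "N \<noteq> 0" for T Q R N z :: complex
    using that by (simp add: field_simps power2_eq_square)
  have eq: "semicircle_defect n t G - S / n =
      - (((\<Sum>i<n. \<Sum>j<n. G j i * G j i) - 2 * (\<Sum>i<n. G i i * G i i)) / ?N\<^sup>2)"
    using algebra[of ?N "\<i> * t"] n unfolding S semicircle_defect_def norm_trace_def by simp
  have "cmod (\<Sum>i<n. \<Sum>j<n. G j i * G j i) \<le> (\<Sum>i<n. \<Sum>j<n. (cmod (G j i))\<^sup>2)"
    by (intro sum_norm_le) (auto simp: norm_mult power2_eq_square)
  also have "\<dots> \<le> (\<Sum>i<n. 1 / t\<^sup>2)" by (intro sum_mono is_resolvent_column[OF G]) auto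
  finally have 1: "cmod (\<Sum>i<n. \<Sum>j<n. G j i * G j i) \<le> n / t\<^sup>2" by simp
  have "cmod (\<Sum>i<n. G i i * G i i) \<le> (\<Sum>i<n. (1 / t)\<^sup>2)"
    unfolding power2_eq_square
  proof (intro sum_norm_le, unfold norm_mult)
    fix i assume "i \<in> {..<n}"
    then show "cmod (G i i) * cmod (G i i) \<le> 1 / t * (1 / t)"
      using t by (intro mult_mono is_resolvent_bound[OF G]) auto
  qed
  then have 2: "cmod (\<Sum>i<n. G i i * G i i) \<le> n / t\<^sup>2" by (simp add: power_divide)
  have "cmod ((\<Sum>i<n. \<Sum>j<n. G j i * G j i) - 2 * (\<Sum>i<n. G i i * G i i)) \<le> n / t\<^sup>2 + 2 * (n / t\<^sup>2)"
    using 1 2 by (intro order_trans[OF norm_triangle_ineq4] add_mono) (auto simp: norm_mult)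
  then have "cmod ((\<Sum>i<n. \<Sum>j<n. G j i * G j i) - 2 * (\<Sum>i<n. G i i * G i i)) / (real n)\<^sup>2 \<le> (3 * (n / t\<^sup>2)) / (real n)\<^sup>2"
    by (intro divide_right_mono) auto
  then show ?thesis unfolding eq using n
    by (simp add: norm_divide norm_mult power2_eq_square mult_ac)
qed

section \<open>The self-consistent equation for random graphs\<close>

definition edge_pmf :: "nat \<Rightarrow> real \<Rightarrow> (nat set \<Rightarrow> bool) pmf" where
  "edge_pmf n p = Pi_pmf (all_edges n) False (\<lambda>_. bernoulli_pmf p)"

definition normalized_adjacency :: "nat \<Rightarrow> real \<Rightarrow> (nat set \<Rightarrow> bool) \<Rightarrow> nat \<Rightarrow> nat \<Rightarrow> real" where
  "normalized_adjacency n p \<xi> i j = (if i = j then 0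
     else (of_bool (\<xi> {Suc i, Suc j}) - p) / sqrt (n * p * (1 - p)))"

lemma finite_all_edges: "finite (all_edges n)"
  unfolding all_edges_def by (rule finite_subset[of _ "Pow {1..n}"]) auto

lemma edge_in_all_edges: "i < n \<Longrightarrow> j < n \<Longrightarrow> i \<noteq> j \<Longrightarrow> {Suc i, Suc j} \<in> all_edges n"
  by (auto simp: all_edges_def)

lemma finite_set_Pi_bernoulli:
  assumes "finite A"
  shows "finite (set_pmf (Pi_pmf A False (\<lambda>_. bernoulli_pmf p)))"
  by (rule finite_subset[OF set_Pi_pmf_subset'[OF assms]]) (use assms in auto)

lemma integrable_edge_pmf:
  fixes f :: "_ \<Rightarrow> 'b::{banach, second_countable_topology}"
  shows "integrable (edge_pmf n p) f"
  unfolding edge_pmf_def by (intro integrable_measure_pmf_finite finite_set_Pi_bernoulli finite_all_edges)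

lemma bernoulli_product_condition:
  fixes F :: "_ \<Rightarrow> 'b::{banach, second_countable_topology}"
  assumes A: "finite A" "e \<in> A" and p: "0 \<le> p" "p \<le> 1"
  defines "M \<equiv> Pi_pmf (A - {e}) False (\<lambda>_. bernoulli_pmf p)"
  shows "measure_pmf.expectation (Pi_pmf A False (\<lambda>_. bernoulli_pmf p)) F =
    p *\<^sub>R measure_pmf.expectation M (\<lambda>\<xi>. F (\<xi>(e := True))) +
    (1 - p) *\<^sub>R measure_pmf.expectation M (\<lambda>\<xi>. F (\<xi>(e := False)))"
proof -
  have fin: "finite (set_pmf M)" unfolding M_def using A by (intro finite_set_Pi_bernoulli) auto
  have "Pi_pmf A False (\<lambda>_. bernoulli_pmf p) =
      bernoulli_pmf p \<bind> (\<lambda>y. map_pmf (\<lambda>\<xi>. \<xi>(e := y)) M)"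
    unfolding M_def using Pi_pmf_insert'[of "A - {e}" e False "\<lambda>_. bernoulli_pmf p"] A
    by (simp add: insert_absorb map_pmf_def)
  then have "measure_pmf.expectation (Pi_pmf A False (\<lambda>_. bernoulli_pmf p)) F =
      (\<Sum>y\<in>UNIV. pmf (bernoulli_pmf p) y *\<^sub>R measure_pmf.expectation (map_pmf (\<lambda>\<xi>. \<xi>(e := y)) M) F)"
    using fin by (simp add: pmf_expectation_bind[where A = UNIV])
  then show ?thesis using p by (simp add: UNIV_bool add.commute)
qed

text \<open>The discrete counterpart of Stein's identity: it is exact, because a function of a two-valued
variable is affine.\<close>

lemma bernoulli_integration_by_parts:
  fixes F :: "_ \<Rightarrow> complex"
  assumes A: "finite A" "e \<in> A" and p: "0 \<le> p" "p \<le> 1"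
  defines "E \<equiv> measure_pmf.expectation (Pi_pmf A False (\<lambda>_. bernoulli_pmf p))"
  shows "E (\<lambda>\<xi>. of_real (of_bool (\<xi> e) - p) * F \<xi>) =
    of_real (p * (1 - p)) * E (\<lambda>\<xi>. F (\<xi>(e := True)) - F (\<xi>(e := False)))"
proof -
  define M where "M = Pi_pmf (A - {e}) False (\<lambda>_. bernoulli_pmf p)"
  have int: "integrable M f" for f :: "_ \<Rightarrow> complex"
    unfolding M_def using A by (intro integrable_measure_pmf_finite finite_set_Pi_bernoulli) auto
  show ?thesis
    unfolding E_def bernoulli_product_condition[OF A p] M_def[symmetric]
    by (simp add: int scaleR_conv_of_real algebra_simps)
qed

lemma norm_expectation_le:
  fixes f :: "_ \<Rightarrow> 'b::{banach, second_countable_topology}"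
  assumes "\<And>x. norm (f x) \<le> K"
  shows "norm (measure_pmf.expectation (edge_pmf n p) f) \<le> K"
proof -
  have "norm (measure_pmf.expectation (edge_pmf n p) f) \<le> measure_pmf.expectation (edge_pmf n p) (\<lambda>x. norm (f x))"
    by (rule integral_norm_bound)
  also have "\<dots> \<le> K"
    using assms by (intro measure_pmf.integral_le_const integrable_edge_pmf) auto
  finally show ?thesis .
qed

lemma normalized_adjacency_sym: "normalized_adjacency n p \<xi> i j = normalized_adjacency n p \<xi> j i"
  by (simp add: normalized_adjacency_def insert_commute)

lemma normalized_adjacency_flip:
  assumes "i \<noteq> j"
  shows "normalized_adjacency n p (\<xi>({Suc i, Suc j} := True)) u v
      - normalized_adjacency n p (\<xi>({Suc i, Suc j} := False)) u v
    = (if (u = i \<and> v = j) \<or> (u = j \<and> v = i) then 1 / sqrt (n * p * (1 - p)) else 0)"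
  using assms by (auto simp: normalized_adjacency_def doubleton_eq_iff diff_divide_distrib)

lemma normalized_adjacency_second_moment:
  assumes p: "0 < p" "p < 1" and ij: "i < n" "j < n"
  shows "measure_pmf.expectation (edge_pmf n p) (\<lambda>\<xi>. (normalized_adjacency n p \<xi> i j)\<^sup>2) \<le> 1 / n"
proof (cases "i = j")
  case False
  define s where "s = n * p * (1 - p)"
  have s: "s > 0" using p ij by (simp add: s_def)
  let ?e = "{Suc i, Suc j}"
  have "measure_pmf.expectation (edge_pmf n p) (\<lambda>\<xi>. (normalized_adjacency n p \<xi> i j)\<^sup>2)
      = p * (1 - p)\<^sup>2 / s + (1 - p) * p\<^sup>2 / s"
    unfolding edge_pmf_def
    using False p s
    by (subst bernoulli_product_condition[OF finite_all_edges edge_in_all_edges[OF ij False]])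
      (simp_all add: normalized_adjacency_def s_def[symmetric] power_divide)
  also have "\<dots> = p * (1 - p) / s" by (simp add: add_divide_distrib[symmetric] power2_eq_square algebra_simps)
  also have "\<dots> = 1 / n" using p by (simp add: s_def)
  finally show ?thesis by simp
qed (simp add: normalized_adjacency_def)

text \<open>With \<open>Z = cnj(Y)\<close>, each summand \<open>E W\<^sub>i\<^sub>j G\<^sub>j\<^sub>i Z\<close> is integrated by parts and cancels against
\<open>(1/n) E (G\<^sub>j\<^sub>j G\<^sub>i\<^sub>i + G\<^sub>j\<^sub>i\<^sup>2) Z\<close> by \<open>entry_flip\<close>. The normalization \<open>c\<^sup>2 p (1-p) = 1/n\<close> of the entries makes
the coefficients agree.\<close>

theorem semicircle_defect_second_moment:
  assumes p: "0 < p" "p < 1" and t: "0 < t" and n: "0 < n"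
    and G: "\<And>\<xi>. is_resolvent n (normalized_adjacency n p \<xi>) t (G \<xi>)"
  shows "measure_pmf.expectation (edge_pmf n p) (\<lambda>\<xi>. (cmod (semicircle_defect n t (G \<xi>)))\<^sup>2)
    \<le> flip_error n t (1 / sqrt (n * p * (1 - p))) + 3 * (2 + 1 / t\<^sup>2) / (t\<^sup>2 * n)"
proof -
  define E where "E f = measure_pmf.expectation (edge_pmf n p) f" for f :: "_ \<Rightarrow> complex"
  define c where "c = 1 / sqrt (n * p * (1 - p))"
  have c: "c > 0" and cc: "c * (p * (1 - p)) = 1 / (n * c)"
  proof -
    have s: "n * p * (1 - p) > 0" using p n by simp
    then show "c > 0" by (simp add: c_def)
    have "c * c = 1 / (n * p * (1 - p))" using s by (simp add: c_def)
    then have "n * c * (c * (p * (1 - p))) = 1" using p n by (simp add: field_simps)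
    then show "c * (p * (1 - p)) = 1 / (n * c)" using \<open>c > 0\<close> n by (simp add: field_simps)
  qed
  let ?W = "normalized_adjacency n p"
  let ?Y = "\<lambda>\<xi>. semicircle_defect n t (G \<xi>)"
  let ?Z = "\<lambda>\<xi>. cnj (?Y \<xi>)"
  let ?D = "flip_error n t c"
  define T where "T i j \<xi> = of_real (?W \<xi> i j) * G \<xi> j i + of_real (1 / n) * (G \<xi> j j * G \<xi> i i + G \<xi> j i * G \<xi> j i)" for i j \<xi>
  define S where "S \<xi> = (\<Sum>i<n. \<Sum>j<n. if i = j then 0 else T i j \<xi>)" for \<xi>
  have int: "integrable (edge_pmf n p) f" for f :: "_ \<Rightarrow> complex" by (rule integrable_edge_pmf)
  have pair: "cmod (E (\<lambda>\<xi>. T i j \<xi> * ?Z \<xi>)) \<le> ?D / n" if ij: "i < n" "j < n" "i \<noteq> j" for i j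
  proof -
    let ?e = "{Suc i, Suc j}"
    define F where "F \<xi> = G \<xi> j i * ?Z \<xi>" for \<xi>
    define H where "H \<xi> = (G \<xi> j j * G \<xi> i i + G \<xi> j i * G \<xi> j i) * ?Z \<xi>" for \<xi>
    have flip: "cmod ((F (\<xi>(?e := True)) - F (\<xi>(?e := False))) + c * H \<xi>) \<le> c * ?D" for \<xi>
    proof -
      have \<xi>: "\<xi>(?e := \<xi> ?e) = \<xi>" by (rule fun_upd_triv)
      have Gcase: "G \<xi> = G (\<xi>(?e := False)) \<or> G \<xi> = G (\<xi>(?e := True))"
        using \<xi> by (cases "\<xi> ?e") simp_all
      have "?W (\<xi>(?e := True)) u v - ?W (\<xi>(?e := False)) u v
          = (if (u = i \<and> v = j) \<or> (u = j \<and> v = i) then c else 0)" for u v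
        using normalized_adjacency_flip[OF ij(3)] by (simp add: c_def)
      note flip = entry_flip[where ?X1.0 = "?W (\<xi>(?e := True))" and ?X0.0 = "?W (\<xi>(?e := False))",
          OF G G Gcase normalized_adjacency_sym ij t c this]
      show ?thesis unfolding F_def H_def by (rule flip)
    qed
    have "E (\<lambda>\<xi>. T i j \<xi> * ?Z \<xi>) = E (\<lambda>\<xi>. of_real c * (of_real (of_bool (\<xi> ?e) - p) * F \<xi>) + of_real (1 / n) * H \<xi>)"
    proof -
      have W: "?W \<xi> i j = c * (of_bool (\<xi> ?e) - p)" for \<xi>
        using ij by (simp add: normalized_adjacency_def c_def)
      show ?thesis
        by (intro arg_cong[of _ _ E] ext)
          (simp only: T_def F_def H_def W of_real_mult distrib_right mult.assoc)
    qed
    also have "\<dots> = of_real c * E (\<lambda>\<xi>. of_real (of_bool (\<xi> ?e) - p) * F \<xi>) + of_real (1 / n) * E H"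
      unfolding E_def by (simp add: int)
    also have "E (\<lambda>\<xi>. of_real (of_bool (\<xi> ?e) - p) * F \<xi>) =
        of_real (p * (1 - p)) * E (\<lambda>\<xi>. F (\<xi>(?e := True)) - F (\<xi>(?e := False)))"
      unfolding E_def edge_pmf_def
      using p by (intro bernoulli_integration_by_parts finite_all_edges edge_in_all_edges ij) auto
    also have "of_real c * (of_real (p * (1 - p)) * E (\<lambda>\<xi>. F (\<xi>(?e := True)) - F (\<xi>(?e := False)))) + of_real (1 / n) * E H
        = of_real (c * (p * (1 - p))) * E (\<lambda>\<xi>. F (\<xi>(?e := True)) - F (\<xi>(?e := False))) + of_real (1 / n) * E H"
      by simp
    also have "\<dots> = of_real (1 / (n * c)) * (E (\<lambda>\<xi>. F (\<xi>(?e := True)) - F (\<xi>(?e := False))) + of_real c * E H)"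
      unfolding cc using c n by (simp add: field_simps)
    also have "E (\<lambda>\<xi>. F (\<xi>(?e := True)) - F (\<xi>(?e := False))) + of_real c * E H
        = E (\<lambda>\<xi>. (F (\<xi>(?e := True)) - F (\<xi>(?e := False))) + of_real c * H \<xi>)"
      unfolding E_def by (simp add: int)
    finally have "cmod (E (\<lambda>\<xi>. T i j \<xi> * ?Z \<xi>)) =
        1 / (n * c) * cmod (E (\<lambda>\<xi>. (F (\<xi>(?e := True)) - F (\<xi>(?e := False))) + of_real c * H \<xi>))"
      using c by (simp add: norm_mult norm_divide)
    also have "\<dots> \<le> 1 / (n * c) * (c * ?D)"
      using c flip unfolding E_def by (intro mult_left_mono norm_expectation_le) auto
    also have "\<dots> = ?D / n" using c by simp
    finally show ?thesis .
  qed
  have D: "0 \<le> ?D" using t c by (auto simp: flip_error_def flip_constant_def)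
  have "E (\<lambda>\<xi>. S \<xi> * ?Z \<xi>) = (\<Sum>i<n. \<Sum>j<n. if i = j then 0 else E (\<lambda>\<xi>. T i j \<xi> * ?Z \<xi>))"
  proof -
    have "(\<lambda>\<xi>. S \<xi> * ?Z \<xi>) = (\<lambda>\<xi>. \<Sum>i<n. \<Sum>j<n. if i = j then 0 else T i j \<xi> * ?Z \<xi>)"
      unfolding S_def sum_distrib_right by (intro ext sum.cong refl) auto
    then show ?thesis
      unfolding E_def by (simp add: int if_distrib cong: if_cong) (intro sum.cong refl, simp)
  qed
  also have "cmod \<dots> \<le> (\<Sum>i<n. \<Sum>j<n. ?D / n)"
    using pair D by (intro order_trans[OF norm_sum] sum_mono) auto
  also have "\<dots> = n * ?D" using n by simp
  finally have SZ: "cmod (E (\<lambda>\<xi>. S \<xi> * ?Z \<xi>)) \<le> n * ?D" .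
  have err: "cmod (?Y \<xi> - S \<xi> / n) \<le> 3 / (t\<^sup>2 * n)" for \<xi>
    unfolding S_def T_def by (rule defect_expansion[OF G t n]) (simp add: normalized_adjacency_def)
  have "cmod (E (\<lambda>\<xi>. (?Y \<xi> - S \<xi> / n) * ?Z \<xi>)) \<le> 3 / (t\<^sup>2 * n) * (2 + 1 / t\<^sup>2)"
    unfolding E_def
  proof (rule norm_expectation_le)
    fix \<xi>
    show "cmod ((?Y \<xi> - S \<xi> / n) * ?Z \<xi>) \<le> 3 / (t\<^sup>2 * n) * (2 + 1 / t\<^sup>2)"
      unfolding norm_mult complex_mod_cnj by (intro mult_mono err semicircle_defect_le[OF G t]) auto
  qed
  moreover have "E (\<lambda>\<xi>. ?Y \<xi> * ?Z \<xi>) = E (\<lambda>\<xi>. (?Y \<xi> - S \<xi> / n) * ?Z \<xi>) + E (\<lambda>\<xi>. S \<xi> * ?Z \<xi>) / n"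
  proof -
    have "(\<lambda>\<xi>. ?Y \<xi> * ?Z \<xi>) = (\<lambda>\<xi>. (?Y \<xi> - S \<xi> / n) * ?Z \<xi> + S \<xi> * ?Z \<xi> / n)"
      by (simp add: algebra_simps)
    then show ?thesis unfolding E_def by (simp add: int)
  qed
  moreover have "cmod (E (\<lambda>\<xi>. S \<xi> * ?Z \<xi>) / n) \<le> ?D"
    using SZ n by (simp add: norm_divide divide_le_eq mult.commute)
  ultimately have "cmod (E (\<lambda>\<xi>. ?Y \<xi> * ?Z \<xi>)) \<le> 3 / (t\<^sup>2 * n) * (2 + 1 / t\<^sup>2) + ?D"
    using norm_triangle_ineq[of "E (\<lambda>\<xi>. (?Y \<xi> - S \<xi> / n) * ?Z \<xi>)" "E (\<lambda>\<xi>. S \<xi> * ?Z \<xi>) / n"] by simp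
  moreover have "E (\<lambda>\<xi>. ?Y \<xi> * ?Z \<xi>) = of_real (measure_pmf.expectation (edge_pmf n p) (\<lambda>\<xi>. (cmod (?Y \<xi>))\<^sup>2))"
    unfolding E_def complex_norm_square[symmetric] by (rule integral_complex_of_real)
  ultimately show ?thesis by (simp add: c_def algebra_simps)
qed

section \<open>From the resolvent to the absolute value\<close>

lemma has_bochner_integral_FTC_nonneg:
  fixes f F :: "real \<Rightarrow> real"
  assumes [measurable]: "f \<in> borel_measurable borel"
    and "\<And>x. 0 \<le> x \<Longrightarrow> DERIV F x :> f x" and nonneg: "\<And>x. 0 \<le> x \<Longrightarrow> 0 \<le> f x"
    and "(F \<longlongrightarrow> T) at_top"
  shows "has_bochner_integral lborel (\<lambda>x. indicator {0..} x * f x) (T - F 0)"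
proof (rule has_bochner_integral_nn_integral)
  have "ennreal (indicator {0..} x * f x) = ennreal (f x) * indicator {0..} x" for x
    by (simp add: indicator_def)
  moreover have "(\<integral>\<^sup>+x. ennreal (f x) * indicator {0..} x \<partial>lborel) = T - F 0"
    by (rule nn_integral_FTC_atLeast) (use assms in auto)
  ultimately show "(\<integral>\<^sup>+x. ennreal (indicator {0..} x * f x) \<partial>lborel) = ennreal (T - F 0)"
    by simp
  show "0 \<le> T - F 0"
  proof -
    have "F 0 \<le> F x" if "0 \<le> x" for x
      using that assms(2,3) by (intro DERIV_nonneg_imp_nondecreasing[of 0 x F]) auto
    then have "F 0 \<le> T"
      by (intro tendsto_lowerbound[OF assms(4)]) (auto simp: eventually_at_top_linorder)
    then show ?thesis by simp
  qed
qed (use nonneg in \<open>auto simp: indicator_def\<close>)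

text \<open>The antiderivative is \<open>\<bar>x\<bar> arctan (t/\<bar>x\<bar>)\<close>.\<close>

lemma abs_as_integral:
  fixes x :: real
  shows "has_bochner_integral lborel (\<lambda>t. indicator {0..} t * (x\<^sup>2 / (x\<^sup>2 + t\<^sup>2))) (pi / 2 * \<bar>x\<bar>)"
proof (cases "x = 0")
  case False
  have "has_bochner_integral lborel (\<lambda>t. indicator {0..} t * (x\<^sup>2 / (x\<^sup>2 + t\<^sup>2)))
      (\<bar>x\<bar> * (pi / 2) - \<bar>x\<bar> * arctan (0 / \<bar>x\<bar>))"
  proof (rule has_bochner_integral_FTC_nonneg)
    fix t :: real
    have "1 + (t / \<bar>x\<bar>)\<^sup>2 = (x\<^sup>2 + t\<^sup>2) / x\<^sup>2" using False by (simp add: power_divide field_simps)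
    then have "\<bar>x\<bar> * (1 / \<bar>x\<bar> * inverse (1 + (t / \<bar>x\<bar>)\<^sup>2)) = x\<^sup>2 / (x\<^sup>2 + t\<^sup>2)"
      using False by simp
    then show "DERIV (\<lambda>t. \<bar>x\<bar> * arctan (t / \<bar>x\<bar>)) t :> x\<^sup>2 / (x\<^sup>2 + t\<^sup>2)"
      using False by (auto intro!: derivative_eq_intros simp: mult_ac divide_inverse)
  next
    have "filterlim (\<lambda>t. t / \<bar>x\<bar>) at_top at_top"
      using False by real_asymp
    then have "((\<lambda>t. arctan (t / \<bar>x\<bar>)) \<longlongrightarrow> pi / 2) at_top"
      by (rule filterlim_compose[OF tendsto_arctan_at_top])
    then show "((\<lambda>t. \<bar>x\<bar> * arctan (t / \<bar>x\<bar>)) \<longlongrightarrow> \<bar>x\<bar> * (pi / 2)) at_top"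
      by (intro tendsto_mult tendsto_const)
  qed auto
  then show ?thesis by (simp add: mult.commute)
qed auto

text \<open>The Stieltjes transform of the semicircle law at \<open>i t\<close> is \<open>i\<close> times this function.\<close>

definition semicircle_stieltjes :: "real \<Rightarrow> real" where
  "semicircle_stieltjes t = (sqrt (t\<^sup>2 + 4) - t) / 2"

lemma semicircle_stieltjes_pos: "0 < semicircle_stieltjes t"
proof -
  have "t < sqrt (t\<^sup>2 + 4)" by (rule real_less_rsqrt) simp
  then show ?thesis by (simp add: semicircle_stieltjes_def)
qed

lemma semicircle_stieltjes_eq: "(semicircle_stieltjes t)\<^sup>2 + t * semicircle_stieltjes t = 1"
proof -
  have "(sqrt (t\<^sup>2 + 4))\<^sup>2 = t\<^sup>2 + 4" by simp
  then show ?thesis by (simp add: semicircle_stieltjes_def field_simps power2_eq_square)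
qed

lemma semicircle_stieltjes_le_1:
  assumes "0 \<le> t"
  shows "semicircle_stieltjes t \<le> 1"
proof -
  have "0 \<le> t * semicircle_stieltjes t" using assms semicircle_stieltjes_pos[of t] by simp
  then have "(semicircle_stieltjes t)\<^sup>2 \<le> 1\<^sup>2" using semicircle_stieltjes_eq[of t] by simp
  then show ?thesis by (rule power2_le_imp_le) simp
qed

text \<open>From \<open>t = 1/s - s\<close> one gets \<open>s\<^sup>2 dt = -(1 + s\<^sup>2) ds\<close>, so \<open>-(s + s\<^sup>3/3)\<close> is an antiderivative; \<open>s\<close>
decreases from \<open>1\<close> to \<open>0\<close>.\<close>

lemma semicircle_stieltjes_square_integral:
  "has_bochner_integral lborel (\<lambda>t. indicator {0..} t * (semicircle_stieltjes t)\<^sup>2) (4 / 3)"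
proof -
  let ?s = semicircle_stieltjes
  let ?F = "\<lambda>t. - (?s t + (?s t) ^ 3 / 3)"
  have "has_bochner_integral lborel (\<lambda>t. indicator {0..} t * (?s t)\<^sup>2) (0 - ?F 0)"
  proof (rule has_bochner_integral_FTC_nonneg)
    show "(\<lambda>t. (?s t)\<^sup>2) \<in> borel_measurable borel"
      unfolding semicircle_stieltjes_def by simp
    fix t :: real
    define q where "q = sqrt (t\<^sup>2 + 4)"
    have q: "q > 0" "q\<^sup>2 = t\<^sup>2 + 4" by (simp_all add: q_def add_nonneg_pos)
    have pos: "0 < t\<^sup>2 + 4" by (simp add: add_nonneg_pos)
    have "DERIV (\<lambda>t. t\<^sup>2 + 4) t :> 2 * t"
      by (auto intro!: derivative_eq_intros)
    from DERIV_chain2[where f = sqrt and g = "\<lambda>t. t\<^sup>2 + 4", OF DERIV_real_sqrt[OF pos] this]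
    have "DERIV (\<lambda>t. sqrt (t\<^sup>2 + 4)) t :> inverse q / 2 * (2 * t)"
      by (simp only: q_def)
    from DERIV_cdivide[OF DERIV_diff[OF this DERIV_ident], of 2]
    have "DERIV ?s t :> (inverse q / 2 * (2 * t) - 1) / 2"
      by (simp only: semicircle_stieltjes_def[abs_def])
    moreover have "(inverse q / 2 * (2 * t) - 1) / 2 = - ?s t / q"
      unfolding semicircle_stieltjes_def q_def[symmetric] using q(1) by (simp add: field_simps)
    ultimately have "DERIV ?s t :> - ?s t / q" by (rule back_subst[of "\<lambda>x. DERIV ?s t :> x"])
    then have "DERIV ?F t :> - (- ?s t / q + (?s t)\<^sup>2 * (- ?s t / q))"
      by (auto intro!: derivative_eq_intros simp: power2_eq_square)
    moreover have "- (- ?s t / q + (?s t)\<^sup>2 * (- ?s t / q)) = (?s t)\<^sup>2"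
    proof -
      have "q = 2 * ?s t + t" by (simp add: semicircle_stieltjes_def q_def field_simps)
      then have "1 + (?s t)\<^sup>2 = q * ?s t"
        using semicircle_stieltjes_eq[of t] by (simp add: power2_eq_square algebra_simps)
      then have "?s t * (1 + (?s t)\<^sup>2) / q = (?s t)\<^sup>2"
        using q(1) by (simp add: power2_eq_square)
      then show ?thesis by (simp add: algebra_simps add_divide_distrib)
    qed
    ultimately show "DERIV ?F t :> (?s t)\<^sup>2" by (simp only:)
  next
    have "(?s \<longlongrightarrow> 0) at_top" unfolding semicircle_stieltjes_def by real_asymp
    then have "(?F \<longlongrightarrow> - (0 + 0 ^ 3 / 3)) at_top" by (intro tendsto_intros) auto
    then show "(?F \<longlongrightarrow> 0) at_top" by simp
  qed simp
  then show ?thesis by (simp add: semicircle_stieltjes_def)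
qed

text \<open>The quadratic factors as \<open>(m - i s) (m + i/s)\<close>, and the second factor has imaginary part at least
\<open>1/s \<ge> 1\<close> in the upper half plane.\<close>

lemma semicircle_fixed_point_stable:
  assumes t: "0 \<le> t" and m: "0 \<le> Im m"
  shows "cmod (m - \<i> * semicircle_stieltjes t) \<le> cmod (1 + \<i> * t * m + m\<^sup>2)"
proof -
  define s where "s = semicircle_stieltjes t"
  have s: "0 < s" "s \<le> 1" "s\<^sup>2 + t * s = 1"
    using semicircle_stieltjes_pos semicircle_stieltjes_le_1[OF t] semicircle_stieltjes_eq by (simp_all add: s_def)
  have "t = 1 / s - s" using s by (simp add: field_simps power2_eq_square)
  then have t_eq: "complex_of_real t = 1 / of_real s - of_real s" by simp
  have "1 + \<i> * t * m + m\<^sup>2 = (m - \<i> * s) * (m + \<i> * (1 / s))"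
    unfolding t_eq using s(1) by (simp add: field_simps power2_eq_square)
  moreover have "1 \<le> cmod (m + \<i> * (1 / s))"
  proof -
    have "1 \<le> 1 / s" using s by simp
    also have "\<dots> \<le> Im (m + \<i> * (1 / s))" using m by simp
    also have "\<dots> \<le> cmod (m + \<i> * (1 / s))" by (rule order_trans[OF abs_ge_self abs_Im_le_cmod])
    finally show ?thesis .
  qed
  then have "cmod (m - \<i> * s) * 1 \<le> cmod (m - \<i> * s) * cmod (m + \<i> * (1 / s))"
    by (intro mult_left_mono) auto
  ultimately show ?thesis by (simp add: norm_mult s_def)
qed

lemma trace_identities:
  assumes sd: "spectral_decomposition n X P l" and t: "0 < t" and n: "0 < n"
  defines "m \<equiv> norm_trace n (spectral_resolvent n P l t)"
  shows "0 \<le> Im m" and "(\<Sum>k<n. (l k)\<^sup>2 / ((l k)\<^sup>2 + t\<^sup>2)) / n = 1 - t * Im m"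
proof -
  have Im1: "Im (1 / (of_real x - \<i> * of_real t)) = t / (x\<^sup>2 + t\<^sup>2)" for x
    by (simp add: Im_divide power2_eq_square)
  have Im: "Im m = (\<Sum>k<n. t / ((l k)\<^sup>2 + t\<^sup>2)) / n"
    unfolding m_def norm_trace_def trace_spectral_resolvent[OF sd]
    by (simp add: Im1 Im_divide_of_nat)
  show "0 \<le> Im m" unfolding Im using t by (intro divide_nonneg_nonneg sum_nonneg) auto
  have "(\<Sum>k<n. (l k)\<^sup>2 / ((l k)\<^sup>2 + t\<^sup>2)) = (\<Sum>k<n. 1 - t * (t / ((l k)\<^sup>2 + t\<^sup>2)))"
  proof (intro sum.cong refl)
    fix k
    have "(l k)\<^sup>2 + t\<^sup>2 > 0" using t by (simp add: add_nonneg_pos)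
    then have "1 - t\<^sup>2 / ((l k)\<^sup>2 + t\<^sup>2) = ((l k)\<^sup>2 + t\<^sup>2 - t\<^sup>2) / ((l k)\<^sup>2 + t\<^sup>2)"
      by (simp only: diff_divide_distrib divide_self)
    then show "(l k)\<^sup>2 / ((l k)\<^sup>2 + t\<^sup>2) = 1 - t * (t / ((l k)\<^sup>2 + t\<^sup>2))"
      by (simp add: power2_eq_square)
  qed
  also have "\<dots> = n - t * (\<Sum>k<n. t / ((l k)\<^sup>2 + t\<^sup>2))"
    by (simp add: sum_subtractf sum_distrib_left)
  finally show "(\<Sum>k<n. (l k)\<^sup>2 / ((l k)\<^sup>2 + t\<^sup>2)) / n = 1 - t * Im m"
    unfolding Im using n by (simp add: diff_divide_distrib)
qed

text \<open>Both sides are the trace of the square of \<open>X\<close>.\<close>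

lemma eigenvalue_square_sum:
  assumes sd: "spectral_decomposition n X P l"
  shows "(\<Sum>k<n. (l k)\<^sup>2) = (\<Sum>i<n. \<Sum>j<n. (X i j)\<^sup>2)"
proof -
  have cols: "(\<Sum>i<n. P i k * P i h) = (if k = h then 1 else 0)" if "k < n" "h < n" for k h
    using sd that by (simp add: spectral_decomposition_def)
  have "(\<Sum>i<n. \<Sum>j<n. (X i j)\<^sup>2) =
      (\<Sum>i<n. \<Sum>j<n. \<Sum>k<n. \<Sum>h<n. l k * l h * ((P i k * P i h) * (P j k * P j h)))"
    using sd by (intro sum.cong refl)
      (simp add: spectral_decomposition_def power2_eq_square sum_product mult_ac)
  also have "\<dots> = (\<Sum>i<n. \<Sum>k<n. \<Sum>j<n. \<Sum>h<n. l k * l h * ((P i k * P i h) * (P j k * P j h)))"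
    by (intro sum.cong refl sum.swap)
  also have "\<dots> = (\<Sum>k<n. \<Sum>i<n. \<Sum>j<n. \<Sum>h<n. l k * l h * ((P i k * P i h) * (P j k * P j h)))"
    by (rule sum.swap)
  also have "\<dots> = (\<Sum>k<n. \<Sum>i<n. \<Sum>h<n. \<Sum>j<n. l k * l h * ((P i k * P i h) * (P j k * P j h)))"
    by (intro sum.cong refl sum.swap)
  also have "\<dots> = (\<Sum>k<n. \<Sum>h<n. \<Sum>i<n. \<Sum>j<n. l k * l h * ((P i k * P i h) * (P j k * P j h)))"
    by (intro sum.cong refl sum.swap)
  also have "\<dots> = (\<Sum>k<n. \<Sum>h<n. l k * l h * ((\<Sum>i<n. P i k * P i h) * (\<Sum>j<n. P j k * P j h)))"
    by (intro sum.cong refl, subst sum_product, simp only: sum_distrib_left)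
  also have "\<dots> = (\<Sum>k<n. \<Sum>h<n. if k = h then l k * l h else 0)"
    using cols by (intro sum.cong refl) auto
  also have "\<dots> = (\<Sum>k<n. (l k)\<^sup>2)" by (simp add: power2_eq_square)
  finally show ?thesis by simp
qed

definition defect_bound :: "real \<Rightarrow> nat \<Rightarrow> real \<Rightarrow> real" where
  "defect_bound p n t = flip_error n t (1 / sqrt (n * p * (1 - p))) + 3 * (2 + 1 / t\<^sup>2) / (t\<^sup>2 * n)"

text \<open>An integrable majorant, uniform in \<open>n\<close>, of the expected deviation of \<open>(1/n) \<Sum> \<lambda>\<^sup>2/(\<lambda>\<^sup>2+t\<^sup>2)\<close> from
\<open>s(t)\<^sup>2\<close>. It rests on \<open>\<lambda>\<^sup>2/(\<lambda>\<^sup>2+t\<^sup>2) \<le> (1+\<lambda>\<^sup>2)/(1+t\<^sup>2)\<close> and on the second moment bound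
\<open>E (1/n) \<Sum> \<lambda>\<^sup>2 \<le> 1\<close>.\<close>

definition dominating :: "real \<Rightarrow> real" where
  "dominating t = 2 * (1 / (1 + t\<^sup>2)) + (semicircle_stieltjes t)\<^sup>2"

lemma integrable_dominating: "integrable lborel (\<lambda>t. indicator {0..} t * dominating t)"
proof -
  have "integrable lborel (\<lambda>t. 2 * (indicator {0..} t * (1\<^sup>2 / (1\<^sup>2 + t\<^sup>2))) + indicator {0..} t * (semicircle_stieltjes t)\<^sup>2 :: real)"
    using abs_as_integral[of 1] semicircle_stieltjes_square_integral
    by (intro Bochner_Integration.integrable_add integrable_mult_right) (auto simp: has_bochner_integral_iff)
  then show ?thesis by (simp add: dominating_def algebra_simps)
qed

lemma defect_bound_nonneg:
  assumes "0 < p" "p < 1" "0 \<le> t"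
  shows "0 \<le> defect_bound p n t"
  using assms by (auto simp: defect_bound_def flip_error_def flip_constant_def)

lemma dominating_nonneg: "0 \<le> dominating t"
  by (simp add: dominating_def)

lemma min_defect_bound_measurable:
  "(\<lambda>t. indicator {0..} t * min (t * sqrt (defect_bound p n t)) (dominating t)) \<in> borel_measurable borel"
  unfolding defect_bound_def flip_error_def flip_constant_def dominating_def semicircle_stieltjes_def
  by measurable

lemma min_defect_bound_le:
  assumes "0 < p" "p < 1"
  shows "\<bar>indicator {0..} t * min (t * sqrt (defect_bound p n t)) (dominating t)\<bar> \<le> indicator {0..} t * dominating t"
proof (cases "0 \<le> t")
  case True
  then have "0 \<le> min (t * sqrt (defect_bound p n t)) (dominating t)"
    using defect_bound_nonneg[OF assms, of t n] dominating_nonneg[of t] by simp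
  then show ?thesis by (simp add: indicator_def)
qed simp

lemma integrable_min_defect_bound:
  assumes "0 < p" "p < 1"
  shows "integrable lborel (\<lambda>t. indicator {0..} t * min (t * sqrt (defect_bound p n t)) (dominating t))"
proof (rule Bochner_Integration.integrable_bound[OF integrable_dominating])
  show "AE t in lborel. norm (indicator {0..} t * min (t * sqrt (defect_bound p n t)) (dominating t))
      \<le> norm (indicator {0..} t * dominating t)"
    using min_defect_bound_le[OF assms] dominating_nonneg by (auto simp: abs_mult)
qed (use min_defect_bound_measurable in simp)

lemma defect_bound_tendsto:
  assumes "0 < p" "p < 1"
  shows "(\<lambda>n. defect_bound p n t) \<longlonglongrightarrow> 0"
proof -
  have "(\<lambda>n. 1 / sqrt (real n * v)) \<longlonglongrightarrow> 0" if "0 < v" for v :: real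
    using that by real_asymp
  from this[of "p * (1 - p)"] assms have c: "(\<lambda>n. 1 / sqrt (real n * p * (1 - p))) \<longlonglongrightarrow> 0" by (simp add: mult.assoc)
  have n: "(\<lambda>n. a / (b * real n)) \<longlonglongrightarrow> 0" for a b :: real
    using tendsto_mult_right_zero[OF lim_inverse_n, of "a / b"] by (simp add: divide_inverse mult_ac)
  have "(\<lambda>n. defect_bound p n t) \<longlonglongrightarrow>
      2 * (flip_constant t * 0) * (2 * (1 / t) * (2 + 1 / t\<^sup>2) + (1 / t)\<^sup>2) + 0 + 0"
    unfolding defect_bound_def flip_error_def by (intro tendsto_intros c n)
  then show ?thesis by simp
qed

lemma expectation_le_sqrt:
  "measure_pmf.expectation (edge_pmf n p) f \<le> sqrt (measure_pmf.expectation (edge_pmf n p) (\<lambda>\<xi>. (f \<xi>)\<^sup>2))"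
  for f :: "_ \<Rightarrow> real"
proof (rule real_le_rsqrt)
  have "0 \<le> measure_pmf.variance (edge_pmf n p) f" by (rule measure_pmf.variance_positive)
  then show "(measure_pmf.expectation (edge_pmf n p) f)\<^sup>2 \<le> measure_pmf.expectation (edge_pmf n p) (\<lambda>\<xi>. (f \<xi>)\<^sup>2)"
    by (simp add: measure_pmf.variance_eq integrable_edge_pmf)
qed

lemma expectation_integral_swap:
  fixes g :: "_ \<Rightarrow> real \<Rightarrow> real"
  assumes "\<And>\<xi>. integrable lborel (g \<xi>)"
  shows "measure_pmf.expectation (edge_pmf n p) (\<lambda>\<xi>. integral\<^sup>L lborel (g \<xi>)) =
      integral\<^sup>L lborel (\<lambda>t. measure_pmf.expectation (edge_pmf n p) (\<lambda>\<xi>. g \<xi> t))"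
    and "integrable lborel (\<lambda>t. measure_pmf.expectation (edge_pmf n p) (\<lambda>\<xi>. g \<xi> t))"
proof -
  let ?S = "set_pmf (edge_pmf n p)"
  have S: "finite ?S"
    unfolding edge_pmf_def by (intro finite_set_Pi_bernoulli finite_all_edges)
  have E: "measure_pmf.expectation (edge_pmf n p) f = (\<Sum>\<xi>\<in>?S. pmf (edge_pmf n p) \<xi> * f \<xi>)" for f :: "_ \<Rightarrow> real"
    using integral_measure_pmf[OF S, of "edge_pmf n p" f] by simp
  show "measure_pmf.expectation (edge_pmf n p) (\<lambda>\<xi>. integral\<^sup>L lborel (g \<xi>)) =
      integral\<^sup>L lborel (\<lambda>t. measure_pmf.expectation (edge_pmf n p) (\<lambda>\<xi>. g \<xi> t))"
    unfolding E using assms by simp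
  show "integrable lborel (\<lambda>t. measure_pmf.expectation (edge_pmf n p) (\<lambda>\<xi>. g \<xi> t))"
    unfolding E using assms by simp
qed

text \<open>Write \<open>\<bar>\<lambda>\<bar>\<close> and \<open>8/(3\<pi>)\<close> as integrals over \<open>t\<close> and take the expectation inside. For each \<open>t\<close> the expected
deviation has two bounds: the defect bound, which vanishes as \<open>n\<close> grows but blows up at
\<open>t = 0\<close>, and an integrable one.\<close>

lemma energy_deviation_le_integral:
  assumes p: "0 < p" "p < 1" and n: "0 < n"
  shows "measure_pmf.expectation (edge_pmf n p)
      (\<lambda>\<xi>. \<bar>energy (mat n n (\<lambda>(i,j). normalized_adjacency n p \<xi> i j)) / n - 8 / (3 * pi)\<bar>)
    \<le> 2 / pi * (LINT t|lborel. indicator {0..} t * min (t * sqrt (defect_bound p n t)) (dominating t))"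
proof -
  define E where "E f = measure_pmf.expectation (edge_pmf n p) f" for f :: "_ \<Rightarrow> real"
  let ?W = "normalized_adjacency n p"
  let ?s = semicircle_stieltjes
  have "\<exists>P l. spectral_decomposition n (?W \<xi>) P l \<and>
      energy (mat n n (\<lambda>(i,j). ?W \<xi> i j)) = (\<Sum>k<n. \<bar>l k\<bar>)" for \<xi>
    by (rule spectral_decomposition_exists) (rule normalized_adjacency_sym)
  then obtain P l where sd: "\<And>\<xi>. spectral_decomposition n (?W \<xi>) (P \<xi>) (l \<xi>)"
    and energy: "\<And>\<xi>. energy (mat n n (\<lambda>(i,j). ?W \<xi> i j)) = (\<Sum>k<n. \<bar>l \<xi> k\<bar>)"
    by metis
  define f where "f \<xi> t = (\<Sum>k<n. (l \<xi> k)\<^sup>2 / ((l \<xi> k)\<^sup>2 + t\<^sup>2)) / n" for \<xi> t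
  define h where "h t = E (\<lambda>\<xi>. \<bar>f \<xi> t - (?s t)\<^sup>2\<bar>)" for t
  have int: "integrable (edge_pmf n p) g" for g :: "_ \<Rightarrow> real" by (rule integrable_edge_pmf)
  have mono: "E g \<le> E g'" if "\<And>\<xi>. g \<xi> \<le> g' \<xi>" for g g'
    unfolding E_def using that by (intro integral_mono int)
  have h1: "h t \<le> t * sqrt (defect_bound p n t)" if t: "0 < t" for t
  proof -
    define G where "G \<xi> = spectral_resolvent n (P \<xi>) (l \<xi>) t" for \<xi>
    have G: "is_resolvent n (?W \<xi>) t (G \<xi>)" for \<xi>
      unfolding G_def by (rule spectral_resolvent_is_resolvent[OF sd t])
    define Y where "Y \<xi> = cmod (semicircle_defect n t (G \<xi>))" for \<xi>
    have "\<bar>f \<xi> t - (?s t)\<^sup>2\<bar> \<le> t * Y \<xi>" for \<xi>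
    proof -
      let ?m = "norm_trace n (G \<xi>)"
      have m: "0 \<le> Im ?m" "f \<xi> t = 1 - t * Im ?m"
        using trace_identities[OF sd t n, of \<xi>] by (simp_all add: f_def G_def)
      have "f \<xi> t - (?s t)\<^sup>2 = - (t * (Im ?m - ?s t))"
        using semicircle_stieltjes_eq[of t] by (simp add: m(2) algebra_simps)
      then have "\<bar>f \<xi> t - (?s t)\<^sup>2\<bar> = t * \<bar>Im (?m - \<i> * ?s t)\<bar>" using t by (simp add: abs_mult)
      also have "\<dots> \<le> t * cmod (?m - \<i> * ?s t)" using t by (intro mult_left_mono abs_Im_le_cmod) auto
      also have "\<dots> \<le> t * Y \<xi>"
        unfolding Y_def semicircle_defect_def
        using t m(1) by (intro mult_left_mono semicircle_fixed_point_stable) auto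
      finally show ?thesis .
    qed
    then have "h t \<le> E (\<lambda>\<xi>. t * Y \<xi>)" unfolding h_def by (rule mono)
    also have "\<dots> = t * E Y" by (simp add: E_def)
    also have "\<dots> \<le> t * sqrt (E (\<lambda>\<xi>. (Y \<xi>)\<^sup>2))"
      unfolding E_def using t by (intro mult_left_mono expectation_le_sqrt) auto
    also have "\<dots> \<le> t * sqrt (defect_bound p n t)"
      unfolding E_def Y_def defect_bound_def using t
      by (intro mult_left_mono real_sqrt_le_mono semicircle_defect_second_moment p n G) auto
    finally show ?thesis .
  qed
  have f_nonneg: "0 \<le> f \<xi> t" for \<xi> t unfolding f_def by (intro divide_nonneg_nonneg sum_nonneg) auto
  have h2: "h t \<le> dominating t" if t: "0 < t" for t
  proof -
    (* the average squared eigenvalue *)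
    define \<tau> where "\<tau> \<xi> = (\<Sum>i<n. \<Sum>j<n. (?W \<xi> i j)\<^sup>2) / n" for \<xi>
    have "E \<tau> = (\<Sum>i<n. \<Sum>j<n. E (\<lambda>\<xi>. (?W \<xi> i j)\<^sup>2)) / n"
      unfolding E_def \<tau>_def by (simp add: int)
    also have "\<dots> \<le> (\<Sum>i<n. \<Sum>j<n. 1 / n) / n"
      unfolding E_def by (intro divide_right_mono sum_mono normalized_adjacency_second_moment p) auto
    also have "\<dots> = 1" using n by simp
    finally have \<tau>: "E \<tau> \<le> 1" .
    have "f \<xi> t \<le> (1 + \<tau> \<xi>) * (1 / (1 + t\<^sup>2))" for \<xi>
    proof -
      have "(\<Sum>k<n. (l \<xi> k)\<^sup>2 / ((l \<xi> k)\<^sup>2 + t\<^sup>2)) \<le> (\<Sum>k<n. (1 + (l \<xi> k)\<^sup>2) * (1 / (1 + t\<^sup>2)))"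
      proof (rule sum_mono)
        fix k
        have "(l \<xi> k)\<^sup>2 + t\<^sup>2 > 0" "1 + t\<^sup>2 > 0" using t by (simp_all add: add_nonneg_pos add_pos_nonneg)
        moreover have "(l \<xi> k)\<^sup>2 * (1 + t\<^sup>2) \<le> (1 + (l \<xi> k)\<^sup>2) * ((l \<xi> k)\<^sup>2 + t\<^sup>2)"
          by (simp add: algebra_simps)
        ultimately show "(l \<xi> k)\<^sup>2 / ((l \<xi> k)\<^sup>2 + t\<^sup>2) \<le> (1 + (l \<xi> k)\<^sup>2) * (1 / (1 + t\<^sup>2))"
          by (simp add: divide_simps)
      qed
      also have "\<dots> = (n + (\<Sum>k<n. (l \<xi> k)\<^sup>2)) * (1 / (1 + t\<^sup>2))"
        by (simp only: sum_distrib_right[symmetric] sum.distrib) simp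
      finally have "f \<xi> t \<le> (n + (\<Sum>k<n. (l \<xi> k)\<^sup>2)) * (1 / (1 + t\<^sup>2)) / n"
        unfolding f_def by (rule divide_right_mono) simp
      also have "\<dots> = (1 + \<tau> \<xi>) * (1 / (1 + t\<^sup>2))"
        unfolding eigenvalue_square_sum[OF sd] \<tau>_def using n by (simp add: field_simps)
      finally show ?thesis .
    qed
    then have "\<bar>f \<xi> t - (?s t)\<^sup>2\<bar> \<le> (1 + \<tau> \<xi>) * (1 / (1 + t\<^sup>2)) + (?s t)\<^sup>2" for \<xi>
      using f_nonneg[of \<xi> t] abs_triangle_ineq4[of "f \<xi> t" "(?s t)\<^sup>2"] by (simp add: add_mono order_trans)
    then have "h t \<le> E (\<lambda>\<xi>. (1 + \<tau> \<xi>) * (1 / (1 + t\<^sup>2)) + (?s t)\<^sup>2)"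
      unfolding h_def by (rule mono)
    also have "\<dots> = (1 + E \<tau>) * (1 / (1 + t\<^sup>2)) + (?s t)\<^sup>2"
      unfolding E_def by (simp add: int)
    also have "\<dots> \<le> 2 * (1 / (1 + t\<^sup>2)) + (?s t)\<^sup>2"
      using \<tau> by (intro add_right_mono mult_right_mono) auto
    finally show ?thesis by (simp add: dominating_def)
  qed
  have f_int: "has_bochner_integral lborel (\<lambda>t. indicator {0..} t * f \<xi> t) (pi / 2 * ((\<Sum>k<n. \<bar>l \<xi> k\<bar>) / n))" for \<xi>
  proof -
    have "has_bochner_integral lborel (\<lambda>t. (\<Sum>k<n. indicator {0..} t * ((l \<xi> k)\<^sup>2 / ((l \<xi> k)\<^sup>2 + t\<^sup>2))) / n)
        ((\<Sum>k<n. pi / 2 * \<bar>l \<xi> k\<bar>) / n)"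
      by (intro has_bochner_integral_divide has_bochner_integral_sum abs_as_integral)
    then show ?thesis by (simp add: f_def sum_distrib_left)
  qed
  let ?g = "\<lambda>\<xi> t. indicator {0..} t * \<bar>f \<xi> t - (?s t)\<^sup>2\<bar>"
  have diff_int: "has_bochner_integral lborel (\<lambda>t. indicator {0..} t * f \<xi> t - indicator {0..} t * (?s t)\<^sup>2)
      (pi / 2 * ((\<Sum>k<n. \<bar>l \<xi> k\<bar>) / n) - 4 / 3)" for \<xi>
    by (intro has_bochner_integral_diff f_int semicircle_stieltjes_square_integral)
  have g_eq: "?g \<xi> t = \<bar>indicator {0..} t * f \<xi> t - indicator {0..} t * (?s t)\<^sup>2\<bar>" for \<xi> t
    by (simp add: indicator_def)
  have g_int: "integrable lborel (?g \<xi>)" for \<xi>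
    unfolding g_eq using diff_int by (intro integrable_abs) (auto simp: has_bochner_integral_iff)
  have "\<bar>energy (mat n n (\<lambda>(i,j). ?W \<xi> i j)) / n - 8 / (3 * pi)\<bar> \<le> 2 / pi * integral\<^sup>L lborel (?g \<xi>)" for \<xi>
  proof -
    have "energy (mat n n (\<lambda>(i,j). ?W \<xi> i j)) / n - 8 / (3 * pi) =
        2 / pi * (pi / 2 * ((\<Sum>k<n. \<bar>l \<xi> k\<bar>) / n) - 4 / 3)"
      unfolding energy by (simp add: algebra_simps)
    also have "\<dots> = 2 / pi * (LINT t|lborel. indicator {0..} t * f \<xi> t - indicator {0..} t * (?s t)\<^sup>2)"
      using diff_int[of \<xi>] by (simp add: has_bochner_integral_iff)
    also have "\<bar>\<dots>\<bar> \<le> 2 / pi * integral\<^sup>L lborel (?g \<xi>)"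
      unfolding g_eq abs_mult by (simp add: divide_right_mono integral_abs_bound)
    finally show ?thesis .
  qed
  then have "E (\<lambda>\<xi>. \<bar>energy (mat n n (\<lambda>(i,j). ?W \<xi> i j)) / n - 8 / (3 * pi)\<bar>)
      \<le> E (\<lambda>\<xi>. 2 / pi * integral\<^sup>L lborel (?g \<xi>))" by (rule mono)
  also have "\<dots> = 2 / pi * E (\<lambda>\<xi>. integral\<^sup>L lborel (?g \<xi>))" by (simp add: E_def)
  also have "E (\<lambda>\<xi>. integral\<^sup>L lborel (?g \<xi>)) = (LINT t|lborel. E (\<lambda>\<xi>. ?g \<xi> t))"
    unfolding E_def by (rule expectation_integral_swap(1)[OF g_int])
  also have "(\<lambda>t. E (\<lambda>\<xi>. ?g \<xi> t)) = (\<lambda>t. indicator {0..} t * h t)"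
    by (simp add: E_def h_def)
  finally have "E (\<lambda>\<xi>. \<bar>energy (mat n n (\<lambda>(i,j). ?W \<xi> i j)) / n - 8 / (3 * pi)\<bar>)
      \<le> 2 / pi * (LINT t|lborel. indicator {0..} t * h t)" .
  also have "\<dots> \<le> 2 / pi * (LINT t|lborel. indicator {0..} t * min (t * sqrt (defect_bound p n t)) (dominating t))"
  proof (rule mult_left_mono, rule integral_mono_AE)
    show "integrable lborel (\<lambda>t. indicator {0..} t * h t)"
      using expectation_integral_swap(2)[OF g_int, of n p] by (simp add: E_def h_def)
    show "integrable lborel (\<lambda>t. indicator {0..} t * min (t * sqrt (defect_bound p n t)) (dominating t))"
      by (rule integrable_min_defect_bound[OF p])
    show "AE t in lborel. indicator {0..} t * h t \<le> indicator {0..} t * min (t * sqrt (defect_bound p n t)) (dominating t)"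
      (* both bounds are only available for positive t *)
      using AE_lborel_singleton[of 0]
    proof eventually_elim
      case (elim t)
      then show ?case using h1[of t] h2[of t] by (auto simp: indicator_def)
    qed
  qed simp
  finally show ?thesis unfolding E_def .
qed

theorem energy_normalized_adjacency_limit:
  assumes p: "0 < p" "p < 1"
  shows "(\<lambda>n. measure_pmf.expectation (edge_pmf n p)
      (\<lambda>\<xi>. \<bar>energy (mat n n (\<lambda>(i,j). normalized_adjacency n p \<xi> i j)) / n - 8 / (3 * pi)\<bar>)) \<longlonglongrightarrow> 0"
proof -
  let ?b = "\<lambda>n t. indicator {0..} t * min (t * sqrt (defect_bound p n t)) (dominating t)"
  have "(\<lambda>n. integral\<^sup>L lborel (?b n)) \<longlonglongrightarrow> integral\<^sup>L lborel (\<lambda>_::real. 0 :: real)"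
  proof (rule integral_dominated_convergence[OF _ _ integrable_dominating])
    show "AE t in lborel. (\<lambda>n. ?b n t) \<longlonglongrightarrow> 0"
    proof (intro AE_I2)
      fix t :: real
      have "(\<lambda>n. ?b n t) \<longlonglongrightarrow> indicator {0..} t * min (t * sqrt 0) (dominating t)"
        by (intro tendsto_intros defect_bound_tendsto p)
      then show "(\<lambda>n. ?b n t) \<longlonglongrightarrow> 0" using dominating_nonneg[of t] by simp
    qed
    show "AE t in lborel. norm (?b n t) \<le> indicator {0..} t * dominating t" for n
      using min_defect_bound_le[OF p] by simp
  qed (use min_defect_bound_measurable in simp_all)
  then have "(\<lambda>n. 2 / pi * integral\<^sup>L lborel (?b n)) \<longlonglongrightarrow> 0"
    using tendsto_mult_right_zero by fastforce
  then show ?thesis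
  proof (rule tendsto_sandwich[OF _ _ tendsto_const, rotated 2])
    show "\<forall>\<^sub>F n in sequentially. measure_pmf.expectation (edge_pmf n p)
      (\<lambda>\<xi>. \<bar>energy (mat n n (\<lambda>(i,j). normalized_adjacency n p \<xi> i j)) / n - 8 / (3 * pi)\<bar>)
        \<le> 2 / pi * integral\<^sup>L lborel (?b n)"
      using eventually_gt_at_top[of 0] by eventually_elim (rule energy_deviation_le_integral[OF p])
  qed (auto intro!: always_eventually integral_nonneg_AE)
qed

section \<open>Degree concentration and the Randic matrix\<close>

lemma prob_erdos_renyi:
  "measure_pmf.prob (erdos_renyi n p) S =
    measure_pmf.prob (edge_pmf n p) {\<xi>. {e \<in> all_edges n. \<xi> e} \<in> S}"
  by (simp add: erdos_renyi_def edge_pmf_def vimage_def)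

lemma card_incident_edges:
  assumes "v \<in> {1..n}"
  shows "card {e \<in> all_edges n. v \<in> e} = n - 1"
proof -
  have "{e \<in> all_edges n. v \<in> e} = (\<lambda>u. {v, u}) ` ({1..n} - {v})"
  proof (intro equalityI subsetI)
    fix e assume "e \<in> {e \<in> all_edges n. v \<in> e}"
    then obtain a b where e: "e = {a, b}" "a \<noteq> b" "v \<in> e" "e \<subseteq> {1..n}"
      by (auto simp: all_edges_def card_2_iff)
    then show "e \<in> (\<lambda>u. {v, u}) ` ({1..n} - {v})" by (auto simp: insert_commute)
  qed (use assms in \<open>auto simp: all_edges_def\<close>)
  moreover have "inj_on (\<lambda>u. {v, u}) ({1..n} - {v})"
    by (auto simp: inj_on_def doubleton_eq_iff)
  ultimately show ?thesis using assms by (simp add: card_image)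
qed

text \<open>The degree is binomial with parameters \<open>n - 1\<close> and \<open>p\<close>, so this is Hoeffding's inequality.\<close>

lemma degree_tail:
  assumes p: "0 < p" "p < 1" and v: "v \<in> {1..n}" and "0 \<le> \<epsilon>" "2 \<le> n"
  shows "measure_pmf.prob (edge_pmf n p)
      {\<xi>. \<bar>real (degree_of {e \<in> all_edges n. \<xi> e} v) - real (n - 1) * p\<bar> \<ge> \<epsilon>}
    \<le> 2 * exp (- 2 * \<epsilon>\<^sup>2 / real (n - 1))"
proof -
  let ?A = "{e \<in> all_edges n. v \<in> e}"
  have A: "finite ?A" "?A \<subseteq> all_edges n" "card ?A = n - 1"
    using finite_all_edges card_incident_edges[OF v] by auto
  have deg: "degree_of {e \<in> all_edges n. \<xi> e} v = card {e \<in> ?A. if e \<in> ?A then \<xi> e else False}" for \<xi>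
    unfolding degree_of_def by (intro arg_cong[of _ _ card]) auto
  have "binomial_pmf (n - 1) p = map_pmf (\<lambda>\<xi>. card {e \<in> ?A. \<xi> e}) (Pi_pmf ?A False (\<lambda>_. bernoulli_pmf p))"
    using p by (intro binomial_pmf_altdef' A) auto
  also have "Pi_pmf ?A False (\<lambda>_. bernoulli_pmf p) = map_pmf (\<lambda>\<xi> e. if e \<in> ?A then \<xi> e else False) (edge_pmf n p)"
    unfolding edge_pmf_def by (rule Pi_pmf_subset[OF finite_all_edges A(2)])
  finally have "binomial_pmf (n - 1) p = map_pmf (\<lambda>\<xi>. degree_of {e \<in> all_edges n. \<xi> e} v) (edge_pmf n p)"
    by (simp add: pmf.map_comp o_def deg)
  then have "measure_pmf.prob (edge_pmf n p)
      {\<xi>. \<bar>real (degree_of {e \<in> all_edges n. \<xi> e} v) - real (n - 1) * p\<bar> \<ge> \<epsilon>}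
      = measure_pmf.prob (binomial_pmf (n - 1) p) {x. \<bar>real x - real (n - 1) * p\<bar> \<ge> \<epsilon>}"
    by (simp add: vimage_def)
  also have "\<dots> \<le> 2 * exp (- 2 * \<epsilon>\<^sup>2 / real (n - 1))"
  proof -
    interpret binomial_distribution "n - 1" p using p by unfold_locales auto
    show ?thesis using prob_abs_ge[OF _ \<open>0 \<le> \<epsilon>\<close>] \<open>2 \<le> n\<close> by simp
  qed
  finally show ?thesis .
qed

definition regular_upto :: "nat \<Rightarrow> real \<Rightarrow> real \<Rightarrow> nat set set \<Rightarrow> bool" where
  "regular_upto n p \<delta> E \<longleftrightarrow> (\<forall>v\<in>{1..n}. \<bar>real (degree_of E v) - p * n\<bar> \<le> \<delta> * (p * n))"

text \<open>A union bound over the vertices: the exponential tail beats the factor \<open>n\<close>. Half of the allowed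
deviation absorbs the difference between \<open>(n - 1) p\<close> and \<open>p n\<close>.\<close>

lemma irregular_prob_tendsto:
  assumes p: "0 < p" "p < 1" and \<delta>: "0 < \<delta>"
  shows "(\<lambda>n. measure_pmf.prob (edge_pmf n p) {\<xi>. \<not> regular_upto n p \<delta> {e \<in> all_edges n. \<xi> e}}) \<longlonglongrightarrow> 0"
proof (rule tendsto_sandwich[OF _ _ tendsto_const])
  have "(\<lambda>n. real n * (2 * exp (- v / 2 * real n))) \<longlonglongrightarrow> 0" if "0 < v" for v :: real
    using that by real_asymp
  from this[of "(\<delta> * p)\<^sup>2"] show "(\<lambda>n. real n * (2 * exp (- (\<delta> * p)\<^sup>2 / 2 * real n))) \<longlonglongrightarrow> 0"
    using p \<delta> by simp
  show "\<forall>\<^sub>F n in sequentially. measure_pmf.prob (edge_pmf n p) {\<xi>. \<not> regular_upto n p \<delta> {e \<in> all_edges n. \<xi> e}}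
      \<le> real n * (2 * exp (- (\<delta> * p)\<^sup>2 / 2 * real n))"
    using eventually_ge_at_top[of "nat \<lceil>2 / \<delta>\<rceil> + 2"]
  proof eventually_elim
    case (elim n)
    then have n: "2 \<le> n" "2 / \<delta> \<le> n" by linarith+
    define \<epsilon> where "\<epsilon> = \<delta> * p * n / 2"
    have \<epsilon>: "0 \<le> \<epsilon>" using p \<delta> by (simp add: \<epsilon>_def)
    have const: "(\<Sum>v\<in>{1..n}. c) = n * c" for c :: real by simp
    have "2 \<le> \<delta> * n" using n \<delta> by (simp add: divide_le_eq mult.commute)
    then have "p * 2 \<le> p * (\<delta> * n)" using p by (intro mult_left_mono) auto
    then have slack: "p \<le> \<epsilon>" by (simp add: \<epsilon>_def mult_ac)
    let ?bad = "\<lambda>v. {\<xi>. \<bar>real (degree_of {e \<in> all_edges n. \<xi> e} v) - real (n - 1) * p\<bar> \<ge> \<epsilon>}"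
    have "{\<xi>. \<not> regular_upto n p \<delta> {e \<in> all_edges n. \<xi> e}} \<subseteq> (\<Union>v\<in>{1..n}. ?bad v)"
    proof
      fix \<xi> assume "\<xi> \<in> {\<xi>. \<not> regular_upto n p \<delta> {e \<in> all_edges n. \<xi> e}}"
      then obtain v where v: "v \<in> {1..n}" "\<bar>real (degree_of {e \<in> all_edges n. \<xi> e} v) - p * n\<bar> > \<delta> * (p * n)"
        by (auto simp: regular_upto_def not_le)
      have "\<delta> * (p * n) = 2 * \<epsilon>" by (simp add: \<epsilon>_def)
      moreover have "real (n - 1) * p = p * n - p" using n by (simp add: algebra_simps of_nat_diff)
      ultimately have "\<epsilon> \<le> \<bar>real (degree_of {e \<in> all_edges n. \<xi> e} v) - real (n - 1) * p\<bar>"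
        using v(2) slack p by linarith
      then show "\<xi> \<in> (\<Union>v\<in>{1..n}. ?bad v)" using v(1) by blast
    qed
    then have "measure_pmf.prob (edge_pmf n p) {\<xi>. \<not> regular_upto n p \<delta> {e \<in> all_edges n. \<xi> e}}
        \<le> measure_pmf.prob (edge_pmf n p) (\<Union>v\<in>{1..n}. ?bad v)"
      by (intro measure_pmf.finite_measure_mono) auto
    also have "\<dots> \<le> (\<Sum>v\<in>{1..n}. measure_pmf.prob (edge_pmf n p) (?bad v))"
      by (intro measure_pmf.finite_measure_subadditive_finite) auto
    also have "\<dots> \<le> (\<Sum>v\<in>{1..n}. 2 * exp (- 2 * \<epsilon>\<^sup>2 / real (n - 1)))"
      by (intro sum_mono degree_tail p \<epsilon> n) auto
    also have "\<dots> = n * (2 * exp (- 2 * \<epsilon>\<^sup>2 / real (n - 1)))"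
      by (rule const)
    also have "\<dots> \<le> n * (2 * exp (- (\<delta> * p)\<^sup>2 / 2 * n))"
    proof -
      have "2 * \<epsilon>\<^sup>2 / n \<le> 2 * \<epsilon>\<^sup>2 / real (n - 1)" using n by (intro divide_left_mono) auto
      moreover have "2 * \<epsilon>\<^sup>2 / n = (\<delta> * p)\<^sup>2 / 2 * n"
        using n by (simp add: \<epsilon>_def power2_eq_square field_simps)
      ultimately show ?thesis by (intro mult_left_mono) auto
    qed
    finally show ?case .
  qed
qed (simp_all add: always_eventually)

lemma randic_entry_close:
  fixes a b d \<delta> :: real
  assumes d: "0 < d" and \<delta>: "0 \<le> \<delta>" "\<delta> \<le> 1 / 2"
    and a: "\<bar>a - d\<bar> \<le> \<delta> * d" and b: "\<bar>b - d\<bar> \<le> \<delta> * d"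
  shows "\<bar>1 / sqrt (a * b) - 1 / d\<bar> \<le> 2 * \<delta> / d"
proof -
  let ?lo = "(1 - \<delta>) * d" and ?hi = "(1 + \<delta>) * d" and ?r = "sqrt (a * b)"
  have lo: "0 < ?lo" using d \<delta> by simp
  have ab: "?lo \<le> a" "a \<le> ?hi" "?lo \<le> b" "b \<le> ?hi" using a b by (auto simp: abs_le_iff algebra_simps)
  have "?lo * ?lo \<le> a * b" using ab lo by (intro mult_mono) auto
  then have r1: "?lo \<le> ?r" by (intro real_le_rsqrt) (simp add: power2_eq_square)
  have "a * b \<le> ?hi * ?hi" using ab lo by (intro mult_mono) auto
  then have r2: "?r \<le> ?hi" using ab lo by (intro real_le_lsqrt) (auto simp: power2_eq_square)
  have r: "0 < ?r" using r1 lo by linarith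
  have "\<bar>1 / x - 1 / d\<bar> = \<bar>d - x\<bar> / (x * d)" if "0 < x" for x
    using that d by (simp add: diff_frac_eq abs_mult)
  from this[OF r] have "\<bar>1 / ?r - 1 / d\<bar> = \<bar>d - ?r\<bar> / (?r * d)" .
  also have "\<dots> \<le> (\<delta> * d) / (?lo * d)"
    using r1 r2 lo d \<delta> by (intro frac_le mult_right_mono) (auto simp: abs_le_iff algebra_simps)
  also have "\<dots> = \<delta> / ?lo" using d by simp
  also have "\<dots> \<le> \<delta> / (1 / 2 * d)"
    using d \<delta> lo by (intro divide_left_mono mult_right_mono) auto
  also have "\<dots> = 2 * \<delta> / d" by simp
  finally show ?thesis .
qed

text \<open>On edges the entries of the Randic matrix differ from \<open>1/(p n)\<close> by at most \<open>2 \<delta>/(p n)\<close>, so the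
Frobenius norm of the difference to the scaled adjacency matrix is at most \<open>2 \<delta>/p\<close>; the mean part of the adjacency
matrix contributes the \<open>2\<close>.\<close>

lemma randic_energy_close:
  assumes p: "0 < p" "p < 1" and n: "0 < n" and \<delta>: "0 \<le> \<delta>" "\<delta> \<le> 1 / 2"
    and reg: "regular_upto n p \<delta> {e \<in> all_edges n. \<xi> e}"
  shows "\<bar>energy (randic_matrix n {e \<in> all_edges n. \<xi> e})
      - sqrt ((1 - p) / p) / sqrt n * energy (mat n n (\<lambda>(i,j). normalized_adjacency n p \<xi> i j))\<bar>
    \<le> 2 * \<delta> / p * sqrt n + 2"
proof -
  let ?E = "{e \<in> all_edges n. \<xi> e}"
  let ?W = "normalized_adjacency n p \<xi>"
  define R where "R i j = (if {Suc i, Suc j} \<in> ?E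
     then 1 / sqrt (real (degree_of ?E (Suc i)) * real (degree_of ?E (Suc j))) else 0)" for i j
  define d where "d = p * n"
  have d: "0 < d" using p n by (simp add: d_def)
  define \<alpha> where "\<alpha> = sqrt ((1 - p) / p) / sqrt n"
  define F where "F i j = (if {Suc i, Suc j} \<in> ?E then R i j - 1 / d else 0)" for i j
  have \<alpha>W: "\<alpha> * ?W i j = (if i = j then 0 else (of_bool (\<xi> {Suc i, Suc j}) - p) / d)" for i j
  proof -
    have "sqrt ((1 - p) / p) / sqrt n / sqrt (n * p * (1 - p)) = 1 / d"
    proof -
      have "sqrt ((1 - p) / p) / sqrt n / sqrt (n * p * (1 - p)) = sqrt ((1 - p) / p / n / (n * p * (1 - p)))"
        by (simp only: real_sqrt_divide[symmetric])
      also have "(1 - p) / p / n / (n * p * (1 - p)) = 1 / d\<^sup>2"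
        using p n by (simp add: d_def power2_eq_square divide_simps)
      also have "sqrt (1 / d\<^sup>2) = 1 / d" using d by (simp add: real_sqrt_divide)
      finally show ?thesis .
    qed
    then have "\<alpha> * (x / sqrt (n * p * (1 - p))) = x / d" for x
      unfolding \<alpha>_def by (metis mult.commute times_divide_eq_left times_divide_eq_right mult_1)
    then show ?thesis by (simp add: normalized_adjacency_def)
  qed
  have diag: "{Suc i} \<notin> all_edges n" for i by (simp add: all_edges_def)
  have decomp: "R i j - \<alpha> * ?W i j = F i j + p / d * (if i = j then 0 else 1)" if ij: "i < n" "j < n" for i j
  proof (cases "i = j")
    case True
    then show ?thesis using diag[of i] by (simp add: R_def F_def \<alpha>W)
  next
    case False
    then show ?thesis using edge_in_all_edges[OF ij False] by (simp add: R_def F_def \<alpha>W diff_divide_distrib)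
  qed
  have F: "\<bar>F i j\<bar> \<le> 2 * \<delta> / d" if ij: "i < n" "j < n" for i j
  proof (cases "{Suc i, Suc j} \<in> ?E")
    case True
    have "\<bar>real (degree_of ?E (Suc k)) - d\<bar> \<le> \<delta> * d" if "k < n" for k
      using reg that by (simp add: regular_upto_def d_def)
    from randic_entry_close[OF d \<delta> this[OF ij(1)] this[OF ij(2)]]
    show ?thesis using True by (simp add: F_def R_def)
  qed (use d \<delta> in \<open>auto simp: F_def\<close>)
  have "(F i j)\<^sup>2 \<le> (2 * \<delta> / d)\<^sup>2" if "i < n" "j < n" for i j
    using power_mono[OF F[OF that], of 2] by simp
  then have "(\<Sum>i<n. \<Sum>j<n. (F i j)\<^sup>2) \<le> (\<Sum>i<n. \<Sum>j<n. (2 * \<delta> / d)\<^sup>2)"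
    by (intro sum_mono) simp
  also have "\<dots> = (2 * \<delta> / p)\<^sup>2" using n by (simp add: d_def power_divide power_mult_distrib power2_eq_square)
  finally have "sqrt (\<Sum>i<n. \<Sum>j<n. (F i j)\<^sup>2) \<le> sqrt ((2 * \<delta> / p)\<^sup>2)" by (rule real_sqrt_le_mono)
  also have "\<dots> = 2 * \<delta> / p" using p \<delta> by simp
  finally have frob: "sqrt (\<Sum>i<n. \<Sum>j<n. (F i j)\<^sup>2) \<le> 2 * \<delta> / p" .
  have "\<bar>energy (mat n n (\<lambda>(i,j). R i j)) - \<alpha> * energy (mat n n (\<lambda>(i,j). ?W i j))\<bar>
      \<le> sqrt (\<Sum>i<n. \<Sum>j<n. (F i j)\<^sup>2) * sqrt n + 2 * \<bar>p / d\<bar> * n"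
  proof (rule energy_compare)
    show "R i j = R j i" for i j by (simp add: R_def insert_commute mult.commute)
    show "?W i j = ?W j i" for i j by (rule normalized_adjacency_sym)
    show "0 \<le> \<alpha>" using p by (simp add: \<alpha>_def)
  qed (rule decomp)
  also have "\<dots> \<le> 2 * \<delta> / p * sqrt n + 2"
    using p n frob by (intro add_mono mult_right_mono) (auto simp: d_def)
  finally show ?thesis unfolding R_def \<alpha>_def randic_matrix_def .
qed

theorem corollary6:
  fixes p :: real
  assumes "0 < p" and "p < 1"
  shows "\<forall>\<epsilon>>0. (\<lambda>n. measure_pmf.prob (erdos_renyi n p)
            {E. \<bar>energy (randic_matrix n E)
                    / (8 / (3 * pi) * sqrt ((1 - p) / p) * sqrt (real n)) - 1\<bar> > \<epsilon>})
           \<longlonglongrightarrow> 0"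
proof (intro allI impI)
  fix \<epsilon> :: real assume \<epsilon>: "0 < \<epsilon>"
  note p = assms
  define \<kappa> where "\<kappa> = 8 / (3 * pi)"
  define q where "q = sqrt ((1 - p) / p)"
  have \<kappa>: "0 < \<kappa>" by (simp add: \<kappa>_def)
  have q: "0 < q" using p by (simp add: q_def)
  (* delta makes the Frobenius error at most a quarter of epsilon; the mean part takes another
     quarter once n is large, and the deviation of the energy of W the remaining half *)
  define \<delta> where "\<delta> = min (1 / 2) (\<epsilon> * \<kappa> * q * p / 8)"
  have \<delta>: "0 < \<delta>" "\<delta> \<le> 1 / 2" using \<epsilon> \<kappa> q p by (auto simp: \<delta>_def)
  have \<delta>': "2 * \<delta> / p / (\<kappa> * q) \<le> \<epsilon> / 4"
  proof -
    have "\<delta> \<le> \<epsilon> * \<kappa> * q * p / 8" by (simp add: \<delta>_def)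
    then show ?thesis using \<kappa> q p by (simp add: field_simps)
  qed
  define dev where "dev n \<xi> = \<bar>energy (mat n n (\<lambda>(i,j). normalized_adjacency n p \<xi> i j)) / n - \<kappa>\<bar>" for n \<xi>
  have dev_nonneg: "0 \<le> dev n \<xi>" for n \<xi> by (simp add: dev_def)
  define irr where "irr n = {\<xi>. \<not> regular_upto n p \<delta> {e \<in> all_edges n. \<xi> e}}" for n
  let ?bound = "\<lambda>n. measure_pmf.prob (edge_pmf n p) (irr n) + 2 / (\<epsilon> * \<kappa>) * measure_pmf.expectation (edge_pmf n p) (dev n)"
  have "?bound \<longlonglongrightarrow> 0 + 2 / (\<epsilon> * \<kappa>) * 0"
    unfolding irr_def dev_def \<kappa>_def
    by (intro tendsto_intros irregular_prob_tendsto energy_normalized_adjacency_limit p \<delta>)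
  then have lim: "?bound \<longlonglongrightarrow> 0" by simp
  have "(\<lambda>n. 2 / (\<kappa> * q * sqrt (real n))) \<longlonglongrightarrow> 0" using \<kappa> q by real_asymp
  then have "\<forall>\<^sub>F n in sequentially. 2 / (\<kappa> * q * sqrt (real n)) < \<epsilon> / 4"
    using \<epsilon> by (intro order_tendstoD) auto
  then have upper: "\<forall>\<^sub>F n in sequentially. measure_pmf.prob (erdos_renyi n p)
      {E. \<bar>energy (randic_matrix n E) / (8 / (3 * pi) * sqrt ((1 - p) / p) * sqrt (real n)) - 1\<bar> > \<epsilon>} \<le> ?bound n"
    using eventually_gt_at_top[of 0]
  proof eventually_elim
    case (elim n)
    then have n: "0 < n" and small: "2 / (\<kappa> * q * sqrt n) < \<epsilon> / 4" by auto
    define g where "g = \<kappa> * q * sqrt n"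
    have g: "0 < g" using \<kappa> q n by (simp add: g_def)
    let ?R = "\<lambda>\<xi>. energy (randic_matrix n {e \<in> all_edges n. \<xi> e})"
    let ?w = "\<lambda>\<xi>. energy (mat n n (\<lambda>(i,j). normalized_adjacency n p \<xi> i j))"
    have scale: "\<bar>a / g - b / g\<bar> = \<bar>a - b\<bar> / g" for a b
      using g by (simp add: diff_divide_distrib[symmetric])
    have "{\<xi>. \<bar>?R \<xi> / g - 1\<bar> > \<epsilon>} \<subseteq> irr n \<union> {\<xi>. \<epsilon> * \<kappa> / 2 \<le> dev n \<xi>}"
    proof (intro subsetI, rule ccontr)
      fix \<xi> assume big: "\<xi> \<in> {\<xi>. \<bar>?R \<xi> / g - 1\<bar> > \<epsilon>}" and "\<xi> \<notin> irr n \<union> {\<xi>. \<epsilon> * \<kappa> / 2 \<le> dev n \<xi>}"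
      then have reg: "regular_upto n p \<delta> {e \<in> all_edges n. \<xi> e}" and dev: "dev n \<xi> < \<epsilon> * \<kappa> / 2"
        by (auto simp: irr_def)
      have "\<bar>?R \<xi> - q / sqrt n * ?w \<xi>\<bar> / g \<le> (2 * \<delta> / p * sqrt n + 2) / g"
        using randic_energy_close[OF p n less_imp_le[OF \<delta>(1)] \<delta>(2) reg] g
        by (intro divide_right_mono) (auto simp: q_def)
      also have "\<dots> = 2 * \<delta> / p / (\<kappa> * q) + 2 / (\<kappa> * q * sqrt n)"
        using n \<kappa> q p by (simp add: g_def add_divide_distrib)
      also have "\<dots> < \<epsilon> / 2" using \<delta>' small by linarith
      finally have 1: "\<bar>?R \<xi> / g - q / sqrt n * ?w \<xi> / g\<bar> < \<epsilon> / 2"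
        unfolding scale .
      have "q / sqrt n * ?w \<xi> / g = ?w \<xi> / n / \<kappa>"
        using q n by (simp add: g_def)
      then have "\<bar>q / sqrt n * ?w \<xi> / g - 1\<bar> = \<bar>(?w \<xi> / n - \<kappa>) / \<kappa>\<bar>" using \<kappa> by (simp add: diff_divide_distrib)
      also have "\<dots> = dev n \<xi> / \<kappa>" using \<kappa> by (simp add: dev_def)
      also have "\<dots> < \<epsilon> / 2" using dev \<kappa> by (simp add: divide_less_eq)
      finally have "\<bar>?R \<xi> / g - 1\<bar> < \<epsilon>" using 1 by linarith
      then show False using big by simp
    qed
    then have "measure_pmf.prob (edge_pmf n p) {\<xi>. \<bar>?R \<xi> / g - 1\<bar> > \<epsilon>}
        \<le> measure_pmf.prob (edge_pmf n p) (irr n \<union> {\<xi>. \<epsilon> * \<kappa> / 2 \<le> dev n \<xi>})"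
      by (intro measure_pmf.finite_measure_mono) auto
    also have "\<dots> \<le> measure_pmf.prob (edge_pmf n p) (irr n) + measure_pmf.prob (edge_pmf n p) {\<xi>. \<epsilon> * \<kappa> / 2 \<le> dev n \<xi>}"
      by (rule measure_Un_le) auto
    also have "measure_pmf.prob (edge_pmf n p) {\<xi>. \<epsilon> * \<kappa> / 2 \<le> dev n \<xi>}
        \<le> measure_pmf.expectation (edge_pmf n p) (dev n) / (\<epsilon> * \<kappa> / 2)"
      using integral_Markov_inequality_measure[of "edge_pmf n p" "dev n" "{}" "\<epsilon> * \<kappa> / 2"] \<epsilon> \<kappa> dev_nonneg
      by (simp add: integrable_edge_pmf)
    finally show ?case
      unfolding prob_erdos_renyi mem_Collect_eq \<kappa>_def[symmetric] q_def[symmetric] g_def[symmetric]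
      by (simp add: mult.commute)
  qed
  show "(\<lambda>n. measure_pmf.prob (erdos_renyi n p)
      {E. \<bar>energy (randic_matrix n E) / (8 / (3 * pi) * sqrt ((1 - p) / p) * sqrt (real n)) - 1\<bar> > \<epsilon>}) \<longlonglongrightarrow> 0"
    by (rule tendsto_sandwich[OF _ upper tendsto_const lim]) (simp add: always_eventually)
qed

end
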